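(* Let $n\ge 2$ be an integer, let $\mathcal{U}$ be an arbitrary von Neumann algebra with center $\mathrm{Z}(\mathcal{U})$, and let $G_{\mathcal{L}}:\mathcal{U}\to\mathcal{U}$ be a generalized Lie $n$-derivation with associated Lie $n$-derivation $\mathcal{L}$. Then there exist an element $W\in\mathrm{Z}(\mathcal{U})$ and a Lie $n$-derivation $\chi:\mathcal{U}\to\mathcal{U}$ such that $G_{\mathcal{L}}(A)=WA+\chi(A)$ for all $A\in\mathcal{U}$.
   Context: A von Neumann algebra is a weakly closed, self-adjoint algebra of bounded operators on a complex Hilbert space containing the identity operator. $[A,B]=AB-BA$; $p_1(A_1)=A_1$ and $p_n(A_1,\ldots,A_n)=[p_{n-1}(A_1,\ldots,A_{n-1}),A_n]$ for $n\ge 2$. A Lie $n$-derivation is a linear map $\mathcal{L}:\mathcal{U}\to\mathcal{U}$ with $\mathcal{L}(p_n(A_1,\ldots,A_n))=\sum_{i=1}^n p_n(A_1,\ldots,A_{i-1},\mathcal{L}(A_i),A_{i+1},\ldots,A_n)$ for all $A_1,\ldots,A_n\in\mathcal{U}$. A generalized Lie $n$-derivation with associated Lie $n$-derivation $\mathcal{L}$ is a linear map $G_{\mathcal{L}}:\mathcal{U}\to\mathcal{U}$ with $G_{\mathcal{L}}(p_n(A_1,\ldots,A_n))=p_n(G_{\mathcal{L}}(A_1),A_2,\ldots,A_n)+\sum_{i=2}^n p_n(A_1,\ldots,A_{i-1},\mathcal{L}(A_i),A_{i+1},\ldots,A_n)$ for all $A_1,\ldots,A_n\in\mathcal{U}$.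 *)

theory Defs
  imports "HOL-Analysis.Analysis"
begin

text \<open>
  The libraries only provide real inner product spaces, so complex Hilbert spaces are introduced
  as a type class on top of Banach spaces. The inner product is linear in its first argument, and
  the axiom \<open>cinner_self\<close> says that the given complete norm is the one it induces.
\<close>

class complex_hilbert_space = banach +
  fixes scaleC :: "complex \<Rightarrow> 'a \<Rightarrow> 'a"  (infixr "*\<^sub>C" 75)
    and cinner :: "'a \<Rightarrow> 'a \<Rightarrow> complex"
  assumes scaleC_of_real: "complex_of_real r *\<^sub>C x = r *\<^sub>R x"
    and scaleC_add_right: "c *\<^sub>C (x + y) = c *\<^sub>C x + c *\<^sub>C y"
    and scaleC_add_left: "(c + d) *\<^sub>C x = c *\<^sub>C x + d *\<^sub>C x"
    and scaleC_scaleC: "c *\<^sub>C (d *\<^sub>C x) = (c * d) *\<^sub>C x"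
    and cinner_add_left: "cinner (x + y) z = cinner x z + cinner y z"
    and cinner_scaleC_left: "cinner (c *\<^sub>C x) y = c * cinner x y"
    and cinner_commute: "cinner x y = cnj (cinner y x)"
    and cinner_self: "cinner x x = complex_of_real ((norm x)\<^sup>2)"

lemma norm_scaleC: "norm (c *\<^sub>C x) = cmod c * norm x"
  for x :: "'a::complex_hilbert_space"
proof -
  have "complex_of_real ((norm (c *\<^sub>C x))\<^sup>2) = c * cinner x (c *\<^sub>C x)"
    by (metis cinner_self cinner_scaleC_left)
  also have "cinner x (c *\<^sub>C x) = cnj c * cinner x x"
    by (metis cinner_commute cinner_scaleC_left complex_cnj_mult)
  finally have "complex_of_real ((norm (c *\<^sub>C x))\<^sup>2)
      = complex_of_real ((cmod c)\<^sup>2 * (norm x)\<^sup>2)"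
    by (simp only: cinner_self of_real_mult complex_norm_square mult.assoc)
  then have "(norm (c *\<^sub>C x))\<^sup>2 = (cmod c * norm x)\<^sup>2"
    by (simp only: of_real_eq_iff power_mult_distrib)
  then show ?thesis
    by (simp add: power2_eq_iff_nonneg)
qed

lemma bounded_linear_scaleC: "bounded_linear (\<lambda>x::'a::complex_hilbert_space. c *\<^sub>C x)"
proof (rule bounded_linear_intro[where K = "cmod c"])
  show "c *\<^sub>C (r *\<^sub>R x) = r *\<^sub>R (c *\<^sub>C x)" for r and x :: 'a
    by (simp add: scaleC_of_real[symmetric] scaleC_scaleC mult.commute)
qed (simp_all add: scaleC_add_right norm_scaleC mult.commute)

text \<open>
  The type \<open>'h \<Rightarrow>\<^sub>L 'h\<close> consists of the bounded real-linear operators; \<open>bounded_operators\<close> is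
  \<open>B(H)\<close>, the complex-linear ones.
\<close>

definition bounded_operators :: "('h::complex_hilbert_space \<Rightarrow>\<^sub>L 'h) set" where
  "bounded_operators = {A. \<forall>c x. blinfun_apply A (c *\<^sub>C x) = c *\<^sub>C blinfun_apply A x}"

lift_definition op_scaleC ::
    "complex \<Rightarrow> ('h::complex_hilbert_space \<Rightarrow>\<^sub>L 'h) \<Rightarrow> ('h \<Rightarrow>\<^sub>L 'h)"
  is "\<lambda>c A x. c *\<^sub>C A x"
  by (rule bounded_linear_compose[OF bounded_linear_scaleC])

definition is_adjoint ::
    "('h::complex_hilbert_space \<Rightarrow>\<^sub>L 'h) \<Rightarrow> ('h \<Rightarrow>\<^sub>L 'h) \<Rightarrow> bool" where
  "is_adjoint A B \<longleftrightarrow>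
     (\<forall>x y. cinner (blinfun_apply A x) y = cinner x (blinfun_apply B y))"

text \<open>
  The weak operator topology on \<open>B(H)\<close>: the coarsest topology making every matrix coefficient
  \<open>A \<mapsto> \<langle>A x, y\<rangle>\<close> continuous.
\<close>

definition weak_operator_topology :: "('h::complex_hilbert_space \<Rightarrow>\<^sub>L 'h) topology" where
  "weak_operator_topology = topology_generated_by
     {{A \<in> bounded_operators. cinner (blinfun_apply A x) y \<in> S} | x y S. open S}"

definition von_neumann_algebra :: "('h::complex_hilbert_space \<Rightarrow>\<^sub>L 'h) set \<Rightarrow> bool" where
  "von_neumann_algebra U \<longleftrightarrow>
     U \<subseteq> bounded_operators \<and>
     id_blinfun \<in> U \<and>
     (\<forall>A\<in>U. \<forall>B\<in>U. A + B \<in> U) \<and>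
     (\<forall>c. \<forall>A\<in>U. op_scaleC c A \<in> U) \<and>
     (\<forall>A\<in>U. \<forall>B\<in>U. A o\<^sub>L B \<in> U) \<and>
     (\<forall>A\<in>U. \<exists>B\<in>U. is_adjoint A B) \<and>
     closedin weak_operator_topology U"

definition center :: "('h::complex_hilbert_space \<Rightarrow>\<^sub>L 'h) set \<Rightarrow> ('h \<Rightarrow>\<^sub>L 'h) set" where
  "center U = {Z \<in> U. \<forall>A\<in>U. Z o\<^sub>L A = A o\<^sub>L Z}"

definition commutator ::
    "('h::complex_hilbert_space \<Rightarrow>\<^sub>L 'h) \<Rightarrow> ('h \<Rightarrow>\<^sub>L 'h) \<Rightarrow> ('h \<Rightarrow>\<^sub>L 'h)" where
  "commutator A B = (A o\<^sub>L B) - (B o\<^sub>L A)"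

text \<open>
  \<open>lie_poly n A\<close> is \<open>p\<^sub>n(A 1, \<dots>, A n)\<close>; arguments are indexed from 1 and the value at \<open>n = 0\<close>
  is a dummy.
\<close>

fun lie_poly :: "nat \<Rightarrow> (nat \<Rightarrow> 'h::complex_hilbert_space \<Rightarrow>\<^sub>L 'h) \<Rightarrow> ('h \<Rightarrow>\<^sub>L 'h)" where
  "lie_poly 0 A = 0"
| "lie_poly (Suc 0) A = A 1"
| "lie_poly (Suc (Suc n)) A = commutator (lie_poly (Suc n) A) (A (Suc (Suc n)))"

text \<open>
  Maps \<open>U \<rightarrow> U\<close> are total functions on operators; only their values on \<open>U\<close> are constrained.
\<close>

definition linear_self_map ::
    "('h::complex_hilbert_space \<Rightarrow>\<^sub>L 'h) set \<Rightarrow> (('h \<Rightarrow>\<^sub>L 'h) \<Rightarrow> ('h \<Rightarrow>\<^sub>L 'h)) \<Rightarrow> bool" where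
  "linear_self_map U L \<longleftrightarrow>
     (\<forall>A\<in>U. L A \<in> U) \<and>
     (\<forall>A\<in>U. \<forall>B\<in>U. L (A + B) = L A + L B) \<and>
     (\<forall>c. \<forall>A\<in>U. L (op_scaleC c A) = op_scaleC c (L A))"

definition lie_n_derivation ::
    "nat \<Rightarrow> ('h::complex_hilbert_space \<Rightarrow>\<^sub>L 'h) set \<Rightarrow> (('h \<Rightarrow>\<^sub>L 'h) \<Rightarrow> ('h \<Rightarrow>\<^sub>L 'h)) \<Rightarrow> bool" where
  "lie_n_derivation n U L \<longleftrightarrow>
     linear_self_map U L \<and>
     (\<forall>A. (\<forall>i\<in>{1..n}. A i \<in> U) \<longrightarrow>
        L (lie_poly n A) = (\<Sum>i\<in>{1..n}. lie_poly n (A(i := L (A i)))))"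

definition generalized_lie_n_derivation ::
    "nat \<Rightarrow> ('h::complex_hilbert_space \<Rightarrow>\<^sub>L 'h) set \<Rightarrow> (('h \<Rightarrow>\<^sub>L 'h) \<Rightarrow> ('h \<Rightarrow>\<^sub>L 'h)) \<Rightarrow>
       (('h \<Rightarrow>\<^sub>L 'h) \<Rightarrow> ('h \<Rightarrow>\<^sub>L 'h)) \<Rightarrow> bool" where
  "generalized_lie_n_derivation n U L G \<longleftrightarrow>
     lie_n_derivation n U L \<and>
     linear_self_map U G \<and>
     (\<forall>A. (\<forall>i\<in>{1..n}. A i \<in> U) \<longrightarrow>
        G (lie_poly n A) =
          lie_poly n (A(1 := G (A 1))) + (\<Sum>i\<in>{2..n}. lie_poly n (A(i := L (A i)))))"

end

theory Submission
  imports Defs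
begin

text \<open>
  The difference \<open>T = G - L\<close> satisfies \<open>T (p\<^sub>n(A\<^sub>1, \<dots>, A\<^sub>n)) = p\<^sub>n(T A\<^sub>1, A\<^sub>2, \<dots>, A\<^sub>n)\<close>. Since a von
  Neumann algebra has no nonzero central nilpotents, this forces \<open>[T A, B] = [A, T B]\<close>, and it
  remains to find a central \<open>W\<close> with \<open>[T x, y] = W [x, y]\<close>: then \<open>T - W\<close> is central valued and kills
  all \<open>p\<^sub>n\<close>. One may assume that \<open>T\<close> commutes with the adjoint. The relation sending \<open>[x, y] h\<close> to
  \<open>[T x, y] h\<close> then spans a symmetric graph in \<open>H \<times> H\<close> commuting with \<open>U\<close>. By a closed graph
  argument \<open>T\<close> is bounded modulo the center, so the iterates of the graph grow at most
  geometrically; for a symmetric graph this yields boundedness. Extending by zero on the orthogonal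
  complement gives \<open>W\<close>, and \<open>W\<close> lies in \<open>U\<close> as a strong limit of \<open>W e\<close>, where \<open>e\<close> runs through an
  approximate identity of the ideal generated by the commutators.
\<close>

section \<open>Complex Hilbert spaces\<close>

text \<open>Nothing is assumed continuous, and adding a central valued linear map to
  \<open>T\<close> changes no commutator, so in general only estimates modulo
  \<open>center U\<close> are available. The existence of \<open>W\<close> rests on the fact that
  \<open>[T x, y]\<close> is a derivation in each variable, whence
  \<open>[T a, b] [x, y] = [a, b] [T x, y]\<close>. Read through adjoints this is exactly the
  symmetry of the graph, which is why \<open>T\<close> is first split into parts commuting with the
  adjoint. Boundedness then follows as the norm of a symmetric operator is controlled by its
  spectral radius: along vectors \<open>k n\<close> whose consecutive pairs lie in the graph,
  \<open>norm (k n)\<close> is log-convex, so its first ratio cannot exceed the geometric growth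
  rate. Commuting with \<open>U\<close> places \<open>W\<close> only in the commutant, and
  membership in \<open>U\<close> is a separate problem. If \<open>c\<close> and \<open>W c\<close>
  lie in \<open>U\<close> and \<open>d\<close> is the adjoint of \<open>c\<close>, then
  \<open>W (1 - (1 - c d / s) ^ N)\<close> lies in \<open>U\<close> too, and the powers of
  \<open>1 - c d / s\<close> tend to zero on the range of \<open>c\<close>.\<close>

lemma cinner_add_right: "cinner x (y + z) = cinner x y + cinner x z"
  by (metis cinner_add_left cinner_commute complex_cnj_add)

lemma cinner_scaleC_right: "cinner x (c *\<^sub>C y) = cnj c * cinner x y"
  by (metis cinner_commute cinner_scaleC_left complex_cnj_mult)

lemma cinner_scaleR_left: "cinner (r *\<^sub>R x) y = r *\<^sub>R cinner x y"
  by (metis cinner_scaleC_left scaleC_of_real scaleR_conv_of_real)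

lemma cinner_scaleR_right: "cinner x (r *\<^sub>R y) = r *\<^sub>R cinner x y"
  by (metis cinner_scaleC_right complex_cnj_complex_of_real scaleC_of_real scaleR_conv_of_real)

lemma Re_cinner_self: "Re (cinner x x) = (norm x)\<^sup>2"
  by (simp add: cinner_self)

lemma Re_cinner_commute: "Re (cinner x y) = Re (cinner y x)"
  by (metis cinner_commute cnj.sel(1))

lemma cinner_minus_right: "cinner x (- y) = - cinner x y"
  using cinner_scaleR_right[of x "-1" y] by simp

lemma cinner_minus_left: "cinner (- x) y = - cinner x y"
  using cinner_scaleR_left[of "-1" x y] by simp

lemma norm_diff_sq: "(norm (x - y))\<^sup>2 = (norm x)\<^sup>2 - 2 * Re (cinner x y) + (norm y)\<^sup>2"
proof -
  have "cinner (x + - y) (x + - y) = cinner x x - cinner x y - cinner y x + cinner y y"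
    by (simp only: cinner_add_left cinner_add_right cinner_minus_left cinner_minus_right) simp
  then have "Re (cinner (x - y) (x - y)) = Re (cinner x x) - 2 * Re (cinner x y) + Re (cinner y y)"
    using Re_cinner_commute[of x y] by simp
  then show ?thesis
    by (simp add: Re_cinner_self)
qed

lemma norm_add_sq: "(norm (x + y))\<^sup>2 = (norm x)\<^sup>2 + 2 * Re (cinner x y) + (norm y)\<^sup>2"
  using norm_diff_sq[of x "- y"] by (simp add: cinner_minus_right)

lemma parallelogram:
  "(norm (x + y))\<^sup>2 + (norm (x - y))\<^sup>2 = 2 * (norm x)\<^sup>2 + 2 * (norm y)\<^sup>2"
  for x y :: "'a::complex_hilbert_space"
  by (simp add: norm_add_sq norm_diff_sq)

lemma cauchy_schwarz: "cmod (cinner x y) \<le> norm x * norm y"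
proof (cases "cinner x y = 0")
  case False
  \<comment> \<open>The unimodular factor that turns the inner product into its modulus;
    \<open>u\<close> and \<open>v\<close> are then scaled to equal norms.\<close>
  define c where "c = cnj (cinner x y) / cmod (cinner x y)"
  have c: "cmod c = 1" "c * cinner x y = cmod (cinner x y)"
    using False by (auto simp: c_def norm_divide mult.commute complex_norm_square[symmetric] power2_eq_square)
  define u v where "u = norm y *\<^sub>R (c *\<^sub>C x)" and "v = norm x *\<^sub>R y"
  have "0 \<le> (norm (u - v))\<^sup>2" by simp
  also have "\<dots> = 2 * (norm x)\<^sup>2 * (norm y)\<^sup>2 - 2 * (norm x * norm y) * cmod (cinner x y)"
    using c by (simp add: norm_diff_sq u_def v_def cinner_scaleR_left cinner_scaleR_right
        cinner_scaleC_left norm_scaleC power_mult_distrib)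
  finally have "(norm x * norm y) * cmod (cinner x y) \<le> (norm x * norm y) * (norm x * norm y)"
    by (simp add: power2_eq_square mult.commute mult.left_commute)
  moreover have "norm x * norm y > 0"
  proof (rule ccontr)
    assume "\<not> ?thesis"
    then have "x = 0 \<or> y = 0"
      by (metis norm_le_zero_iff not_le_imp_less zero_less_mult_iff)
    then show False
      using False cinner_scaleR_left[of 0 x y] cinner_scaleR_right[of x 0 y] by auto
  qed
  ultimately show ?thesis
    by (metis mult_le_cancel_left_pos)
qed simp

lemma bounded_bilinear_cinner: "bounded_bilinear cinner"
proof
  show "\<exists>K. \<forall>a b. norm (cinner a b) \<le> norm a * norm b * K"
    by (rule exI[of _ 1]) (simp add: cauchy_schwarz)
qed (rule cinner_add_left cinner_add_right cinner_scaleR_left cinner_scaleR_right)+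

interpretation cinner: bounded_bilinear cinner
  by (rule bounded_bilinear_cinner)

lemma cinner_ext:
  assumes "\<And>z. cinner x z = cinner y z"
  shows "x = y"
proof -
  have "cinner (x - y) (x - y) = 0"
    using assms by (simp add: cinner.diff_left)
  then show ?thesis
    by (simp add: cinner_self)
qed

lemma nearest_point_orthogonal:
  fixes K :: "'h::complex_hilbert_space set"
  assumes add: "\<And>x y. x \<in> K \<Longrightarrow> y \<in> K \<Longrightarrow> x + y \<in> K"
    and scale: "\<And>c x. x \<in> K \<Longrightarrow> c *\<^sub>C x \<in> K"
    and k: "k \<in> K" and min: "\<And>x. x \<in> K \<Longrightarrow> norm (h - k) \<le> norm (h - x)"
    and l: "l \<in> K"
  shows "cinner (h - k) l = 0"
proof -
  define u where "u = h - k"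
  have Re0: "Re (cinner u m) = 0" if m: "m \<in> K" for m
  proof (rule ccontr)
    assume nz: "Re (cinner u m) \<noteq> 0"
    then have "m \<noteq> 0" by (auto simp: cinner.zero_right)
    \<comment> \<open>The minimizer of the quadratic function
      \<open>t \<mapsto> (norm (u - t *\<^sub>R m))\<^sup>2\<close>.\<close>
    define t where "t = Re (cinner u m) / (norm m)\<^sup>2"
    have "k + t *\<^sub>R m \<in> K"
      using add[OF k scale[OF m, of "complex_of_real t"]] by (simp add: scaleC_of_real)
    then have "norm u \<le> norm (u - t *\<^sub>R m)"
      using min by (simp add: u_def diff_diff_add)
    then have "(norm u)\<^sup>2 \<le> (norm (u - t *\<^sub>R m))\<^sup>2"
      by (simp add: power_mono)
    also have "\<dots> = (norm u)\<^sup>2 - 2 * t * Re (cinner u m) + t\<^sup>2 * (norm m)\<^sup>2"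
      by (simp add: norm_diff_sq cinner_scaleR_right power_mult_distrib)
    also have "\<dots> = (norm u)\<^sup>2 - (Re (cinner u m))\<^sup>2 / (norm m)\<^sup>2"
      using \<open>m \<noteq> 0\<close> by (simp add: t_def field_simps power2_eq_square)
    finally have "(Re (cinner u m))\<^sup>2 / (norm m)\<^sup>2 \<le> 0" by simp
    moreover have "(Re (cinner u m))\<^sup>2 / (norm m)\<^sup>2 > 0"
      using nz \<open>m \<noteq> 0\<close> by simp
    ultimately show False by simp
  qed
  have "Im (cinner u l) = 0"
    using Re0[OF scale[OF l, of \<i>]] by (simp add: cinner_scaleC_right)
  with Re0[OF l] show ?thesis
    by (simp add: u_def complex_eq_iff)
qed

text \<open>Midpoints of a minimizing sequence stay in \<open>K\<close>, so the parallelogram law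
  makes the sequence Cauchy, and its limit is a nearest point.\<close>

theorem orthogonal_projection_exists:
  fixes K :: "'h::complex_hilbert_space set"
  assumes "closed K" and zero: "0 \<in> K"
    and add: "\<And>x y. x \<in> K \<Longrightarrow> y \<in> K \<Longrightarrow> x + y \<in> K"
    and scale: "\<And>c x. x \<in> K \<Longrightarrow> c *\<^sub>C x \<in> K"
  obtains k where "k \<in> K" "\<And>l. l \<in> K \<Longrightarrow> cinner (h - k) l = 0"
proof -
  define d where "d = (INF x\<in>K. norm (h - x))"
  have bdd: "bdd_below ((\<lambda>x. norm (h - x)) ` K)"
    by (rule bdd_belowI[of _ 0]) auto
  have d_le: "d \<le> norm (h - x)" if "x \<in> K" for x
    unfolding d_def using bdd that by (rule cINF_lower)
  have d0: "0 \<le> d"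
    unfolding d_def using zero by (intro cINF_greatest) auto
  have "\<exists>x\<in>K. norm (h - x) < d + 1 / Suc n" for n
  proof -
    have "Inf ((\<lambda>x. norm (h - x)) ` K) < d + 1 / Suc n"
      by (simp add: d_def)
    then show ?thesis
      using cInf_lessD[of "(\<lambda>x. norm (h - x)) ` K"] zero by blast
  qed
  then obtain f where fK: "\<And>n. f n \<in> K" and fd: "\<And>n. norm (h - f n) < d + 1 / Suc n"
    by metis
  have lim: "(\<lambda>n. norm (h - f n)) \<longlonglongrightarrow> d"
  proof (rule tendsto_sandwich[of "\<lambda>_. d" _ _ "\<lambda>n. d + 1 / Suc n"])
    show "(\<lambda>n. d + 1 / Suc n) \<longlonglongrightarrow> d"
      using tendsto_add[OF tendsto_const LIMSEQ_inverse_real_of_nat, of d]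
      by (simp add: inverse_eq_divide)
  qed (intro always_eventually allI d_le fK less_imp_le fd tendsto_const)+
  have par: "(norm (f m - f n))\<^sup>2 \<le> 2 * (norm (h - f m))\<^sup>2 + 2 * (norm (h - f n))\<^sup>2 - 4 * d\<^sup>2" for m n
  proof -
    have "(1/2) *\<^sub>R (f m + f n) \<in> K"
      using scale[OF add[OF fK fK], of "complex_of_real (1/2)"] by (simp only: scaleC_of_real)
    then have "d \<le> norm (h - (1/2) *\<^sub>R (f m + f n))"
      by (rule d_le)
    also have "h - (1/2) *\<^sub>R (f m + f n) = (1/2) *\<^sub>R ((h - f m) + (h - f n))"
      by (simp add: algebra_simps flip: scaleR_left.add)
    finally have "2 * d \<le> norm ((h - f m) + (h - f n))"
      by simp
    then have "(2 * d)\<^sup>2 \<le> (norm ((h - f m) + (h - f n)))\<^sup>2"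
      using d0 by (intro power_mono) auto
    then show ?thesis
      using parallelogram[of "h - f m" "h - f n"] norm_minus_commute[of "f m" "f n"]
      by (simp add: power_mult_distrib)
  qed
  have "Cauchy f"
  proof (rule metric_CauchyI)
    fix e :: real assume e: "e > 0"
    have "(\<lambda>n. (norm (h - f n))\<^sup>2) \<longlonglongrightarrow> d\<^sup>2"
      by (intro tendsto_intros lim)
    then have "\<forall>\<^sub>F n in sequentially. (norm (h - f n))\<^sup>2 < d\<^sup>2 + e\<^sup>2 / 4"
      using e by (intro order_tendstoD) auto
    then obtain N where N: "\<And>n. n \<ge> N \<Longrightarrow> (norm (h - f n))\<^sup>2 < d\<^sup>2 + e\<^sup>2 / 4"
      by (auto simp: eventually_sequentially)
    show "\<exists>M. \<forall>m\<ge>M. \<forall>n\<ge>M. dist (f m) (f n) < e"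
    proof (intro exI allI impI)
      fix m n assume "m \<ge> N" "n \<ge> N"
      then have "(norm (f m - f n))\<^sup>2 < e\<^sup>2"
        using par[of m n] N[of m] N[of n] by simp
      then show "dist (f m) (f n) < e"
        using e by (simp add: dist_norm power_less_imp_less_base)
    qed
  qed
  then obtain k where fk: "f \<longlonglongrightarrow> k"
    using Cauchy_convergent convergent_def by blast
  have k: "k \<in> K"
    using \<open>closed K\<close> fK fk closed_sequentially by blast
  have "(\<lambda>n. norm (h - f n)) \<longlonglongrightarrow> norm (h - k)"
    by (intro tendsto_intros fk)
  then have "norm (h - k) = d"
    using lim LIMSEQ_unique by blast
  then show thesis
    using that[OF k] nearest_point_orthogonal[OF add scale k] d_le by metis
qed

section \<open>Adjoints and the weak operator topology\<close>

text \<open>Meaningful only where an adjoint exists. For members of a von Neumann algebra existence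
  is part of the definition, and uniqueness makes the choice harmless.\<close>

definition adj :: "('h::complex_hilbert_space \<Rightarrow>\<^sub>L 'h) \<Rightarrow> ('h \<Rightarrow>\<^sub>L 'h)" where
  "adj A = (SOME B. is_adjoint A B)"

lemma is_adjoint_unique: "is_adjoint A B \<Longrightarrow> is_adjoint A C \<Longrightarrow> B = C"
  unfolding is_adjoint_def by (intro blinfun_eqI) (metis cinner_commute cinner_ext)

lemma adj_eq: "is_adjoint A B \<Longrightarrow> adj A = B"
  unfolding adj_def by (metis is_adjoint_unique someI)

lemma is_adjoint_sym: "is_adjoint A B \<Longrightarrow> is_adjoint B A"
  unfolding is_adjoint_def by (metis cinner_commute)

lemma is_adjoint_add: "is_adjoint A B \<Longrightarrow> is_adjoint C D \<Longrightarrow> is_adjoint (A + C) (B + D)"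
  by (simp add: is_adjoint_def blinfun.add_left cinner.add_left cinner.add_right)

lemma is_adjoint_diff: "is_adjoint A B \<Longrightarrow> is_adjoint C D \<Longrightarrow> is_adjoint (A - C) (B - D)"
  by (simp add: is_adjoint_def blinfun.diff_left cinner.diff_left cinner.diff_right)

lemma is_adjoint_compose: "is_adjoint A B \<Longrightarrow> is_adjoint C D \<Longrightarrow> is_adjoint (A o\<^sub>L C) (D o\<^sub>L B)"
  by (simp add: is_adjoint_def)

lemma is_adjoint_op_scaleC: "is_adjoint A B \<Longrightarrow> is_adjoint (op_scaleC c A) (op_scaleC (cnj c) B)"
  by (simp add: is_adjoint_def op_scaleC.rep_eq cinner_scaleC_left cinner_scaleC_right)

lemma is_adjoint_commutator:
  "is_adjoint A B \<Longrightarrow> is_adjoint C D \<Longrightarrow> is_adjoint (commutator A C) (commutator D B)"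
  unfolding commutator_def by (intro is_adjoint_diff is_adjoint_compose)

lemma op_scaleC_of_real: "op_scaleC (complex_of_real r) A = r *\<^sub>R A"
  by (rule blinfun_eqI) (simp add: op_scaleC.rep_eq scaleC_of_real scaleR_blinfun.rep_eq)

text \<open>By Cauchy-Schwarz a matrix coefficient moves little when \<open>A x\<close> does, so the
  strong topology is finer than the weak one. Weak closedness thereby becomes a test on finitely
  many vectors.\<close>

lemma weak_open_contains_strong_nbhd:
  fixes W :: "'h::complex_hilbert_space \<Rightarrow>\<^sub>L 'h"
  assumes "openin weak_operator_topology V" and "W \<in> V"
  shows "\<exists>X e. finite X \<and> e > 0 \<and>
    (\<forall>A\<in>bounded_operators. (\<forall>x\<in>X. norm (blinfun_apply A x - blinfun_apply W x) < e) \<longrightarrow> A \<in> V)"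
proof -
  have "generate_topology_on
     {{A \<in> bounded_operators. cinner (blinfun_apply A x) y \<in> S} | x y S. open S} V"
    using assms(1) unfolding weak_operator_topology_def by (rule openin_topology_generated_by)
  then show ?thesis
    using assms(2)
  proof (induction rule: generate_topology_on.induct)
    case (Int a b)
    then obtain X e Y d where
      "finite X" "e > 0" "finite Y" "d > 0"
      "\<forall>A\<in>bounded_operators. (\<forall>x\<in>X. norm (blinfun_apply A x - blinfun_apply W x) < e) \<longrightarrow> A \<in> a"
      "\<forall>A\<in>bounded_operators. (\<forall>x\<in>Y. norm (blinfun_apply A x - blinfun_apply W x) < d) \<longrightarrow> A \<in> b"
      by auto
    then show ?case
      by (intro exI[of _ "X \<union> Y"] exI[of _ "min e d"]) auto
  next
    case (UN K)
    then obtain k where k: "k \<in> K" "W \<in> k" by blast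
    then show ?case
      using UN.IH[OF k] by blast
  next
    case (Basis s)
    then obtain x y S where s: "s = {A \<in> bounded_operators. cinner (blinfun_apply A x) y \<in> S}" "open S"
      by blast
    with Basis obtain r where r: "r > 0" "ball (cinner (blinfun_apply W x) y) r \<subseteq> S"
      by (auto simp: open_contains_ball)
    \<comment> \<open>Adding 1 keeps the denominator positive when \<open>y = 0\<close>.\<close>
    define e where "e = r / (norm y + 1)"
    have e: "e > 0"
      using r by (simp add: e_def add_nonneg_pos)
    show ?case
    proof (intro exI[of _ "{x}"] exI[of _ e] conjI ballI impI)
      fix A :: "'h \<Rightarrow>\<^sub>L 'h"
      assume A: "A \<in> bounded_operators"
        and "\<forall>x\<in>{x}. norm (blinfun_apply A x - blinfun_apply W x) < e"
      then have "norm (blinfun_apply A x - blinfun_apply W x) * (norm y + 1) < e * (norm y + 1)"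
        by (intro mult_strict_right_mono) (auto simp: add_nonneg_pos)
      also have "\<dots> = r"
        by (simp add: e_def add_nonneg_eq_0_iff)
      finally have "cmod (cinner (blinfun_apply A x - blinfun_apply W x) y) < r"
        using cauchy_schwarz[of "blinfun_apply A x - blinfun_apply W x" y]
          norm_ge_zero[of "blinfun_apply A x - blinfun_apply W x"]
        unfolding distrib_left mult_1_right by linarith
      then have "dist (cinner (blinfun_apply W x) y) (cinner (blinfun_apply A x) y) < r"
        by (simp add: cinner.diff_left dist_norm norm_minus_commute)
      then show "A \<in> s"
        using s r A by auto
    qed (use e in auto)
  qed auto
qed

section \<open>Commutators in a von Neumann algebra\<close>

lemma blinfun_compose_assoc: "(A o\<^sub>L B) o\<^sub>L C = A o\<^sub>L (B o\<^sub>L C)"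
  by (rule blinfun_eqI) simp

lemmas comp_simps = blinfun_compose_assoc
  bounded_bilinear.add_left[OF bounded_bilinear_blinfun_compose]
  bounded_bilinear.add_right[OF bounded_bilinear_blinfun_compose]
  bounded_bilinear.diff_left[OF bounded_bilinear_blinfun_compose]
  bounded_bilinear.diff_right[OF bounded_bilinear_blinfun_compose]
  bounded_bilinear.minus_left[OF bounded_bilinear_blinfun_compose]
  bounded_bilinear.minus_right[OF bounded_bilinear_blinfun_compose]
  bounded_bilinear.scaleR_left[OF bounded_bilinear_blinfun_compose]
  bounded_bilinear.scaleR_right[OF bounded_bilinear_blinfun_compose]

lemma norm_commutator_le: "norm (commutator A B) \<le> 2 * norm A * norm B"
proof -
  have "norm (commutator A B) \<le> norm (A o\<^sub>L B) + norm (B o\<^sub>L A)"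
    unfolding commutator_def by (rule norm_triangle_ineq4)
  also have "\<dots> \<le> norm A * norm B + norm B * norm A"
    by (intro add_mono norm_blinfun_compose)
  finally show ?thesis by simp
qed

lemma bounded_bilinear_commutator:
  "bounded_bilinear (commutator :: ('h::complex_hilbert_space \<Rightarrow>\<^sub>L 'h) \<Rightarrow> _)"
proof
  show "\<exists>K. \<forall>(A :: 'h \<Rightarrow>\<^sub>L 'h) B. norm (commutator A B) \<le> norm A * norm B * K"
  proof (rule exI[of _ 2], intro allI)
    show "norm (commutator A B) \<le> norm A * norm B * 2" for A B :: "'h \<Rightarrow>\<^sub>L 'h"
      using norm_commutator_le[of A B] by (simp add: mult_ac)
  qed
qed (simp_all add: commutator_def comp_simps scaleR_diff_right)

interpretation commutator: bounded_bilinear commutator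
  by (rule bounded_bilinear_commutator)

lemma commutator_swap: "commutator A B = - commutator B A"
  by (simp add: commutator_def)

lemma commutator_self [simp]: "commutator A A = 0"
  by (simp add: commutator_def)

lemma commutator_comp_right:
  "commutator A (B o\<^sub>L C) = (commutator A B o\<^sub>L C) + (B o\<^sub>L commutator A C)"
  by (simp add: commutator_def comp_simps)

lemma commutator_comp_left:
  "commutator (A o\<^sub>L B) C = (commutator A C o\<^sub>L B) + (A o\<^sub>L commutator B C)"
  by (simp add: commutator_def comp_simps)

lemma op_scaleC_comp: "op_scaleC c A o\<^sub>L B = op_scaleC c (A o\<^sub>L B)"
  by (rule blinfun_eqI) (simp add: op_scaleC.rep_eq)

lemma comp_op_scaleC:
  "A \<in> bounded_operators \<Longrightarrow> A o\<^sub>L op_scaleC c B = op_scaleC c (A o\<^sub>L B)"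
  by (rule blinfun_eqI) (simp add: op_scaleC.rep_eq bounded_operators_def)

lemma op_scaleC_scaleC: "op_scaleC c (op_scaleC d A) = op_scaleC (c * d) A"
  by (rule blinfun_eqI) (simp add: op_scaleC.rep_eq scaleC_scaleC)

lemma op_scaleC_zero: "op_scaleC c (0 :: 'a::complex_hilbert_space \<Rightarrow>\<^sub>L 'a) = 0"
proof (rule blinfun_eqI)
  fix x :: 'a
  have "norm (c *\<^sub>C blinfun_apply (0 :: 'a \<Rightarrow>\<^sub>L 'a) x) = 0"
    by (simp only: norm_scaleC) simp
  then show "blinfun_apply (op_scaleC c 0) x = blinfun_apply 0 x"
    by (simp add: op_scaleC.rep_eq)
qed

lemma op_scaleC_diff_right: "op_scaleC c (A - B) = op_scaleC c A - op_scaleC c B"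
  by (rule blinfun_eqI)
    (use scaleC_add_right[of c "blinfun_apply A x - blinfun_apply B x" "blinfun_apply B x" for x]
      in \<open>simp add: op_scaleC.rep_eq blinfun.diff_left algebra_simps\<close>)

lemma op_scaleC_add_right: "op_scaleC c (A + B) = op_scaleC c A + op_scaleC c B"
  by (rule blinfun_eqI) (simp add: op_scaleC.rep_eq blinfun.add_left scaleC_add_right)

lemma commutator_op_scaleC_left:
  "B \<in> bounded_operators \<Longrightarrow> commutator (op_scaleC c A) B = op_scaleC c (commutator A B)"
  by (simp add: commutator_def op_scaleC_comp comp_op_scaleC op_scaleC_diff_right)

lemma commutator_op_scaleC_right:
  "A \<in> bounded_operators \<Longrightarrow> commutator A (op_scaleC c B) = op_scaleC c (commutator A B)"
  by (simp add: commutator_def op_scaleC_comp comp_op_scaleC op_scaleC_diff_right)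

section \<open>Lie polynomials as functions of their first arguments\<close>

lemma lie_poly_cong: "(\<And>i. i \<in> {1..n} \<Longrightarrow> A i = B i) \<Longrightarrow> lie_poly n A = lie_poly n B"
  by (induction n A rule: lie_poly.induct) auto

lemma lie_poly_first_diff:
  "lie_poly n (A(1 := X - Y)) = lie_poly n (A(1 := X)) - lie_poly n (A(1 := Y))"
  by (induction n A rule: lie_poly.induct) (auto simp: commutator.diff_left)

lemma lie_poly_first_zero: "lie_poly n (A(1 := 0)) = 0"
  using lie_poly_first_diff[of n A 0 0] by simp

text \<open>Trades the first two arguments for their commutator. From the third argument on the
  entries are \<open>C 2\<close>, \<open>C 3\<close> and so on, hence the shift
  \<open>i - 1\<close>; the entry \<open>C 1\<close> is overwritten.\<close>

lemma lie_poly_merge: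
  "lie_poly (Suc (Suc m)) (\<lambda>i. if i = 1 then X else if i = 2 then Y else C (i - 1))
    = lie_poly (Suc m) (C(1 := commutator X Y))"
  by (induction m) (auto simp: numeral_2_eq_2)

section \<open>Algebraic and topological closure properties of a von Neumann algebra\<close>

locale von_neumann =
  fixes U :: "('h::complex_hilbert_space \<Rightarrow>\<^sub>L 'h) set"
  assumes vn: "von_neumann_algebra U"
begin

lemma bounded_op: "A \<in> U \<Longrightarrow> A \<in> bounded_operators"
  and id_in [simp]: "id_blinfun \<in> U"
  and add_in [simp]: "A \<in> U \<Longrightarrow> B \<in> U \<Longrightarrow> A + B \<in> U"
  and scaleC_in [simp]: "A \<in> U \<Longrightarrow> op_scaleC c A \<in> U"
  and comp_in [simp]: "A \<in> U \<Longrightarrow> B \<in> U \<Longrightarrow> A o\<^sub>L B \<in> U"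
  and ex_adjoint: "A \<in> U \<Longrightarrow> \<exists>B\<in>U. is_adjoint A B"
  using vn unfolding von_neumann_algebra_def by blast+

lemma scaleR_in [simp]: "A \<in> U \<Longrightarrow> r *\<^sub>R A \<in> U"
  by (metis op_scaleC_of_real scaleC_in)

lemma minus_in [simp]: "A \<in> U \<Longrightarrow> - A \<in> U"
  using scaleR_in[of A "-1"] by simp

lemma diff_in [simp]: "A \<in> U \<Longrightarrow> B \<in> U \<Longrightarrow> A - B \<in> U"
  by (metis add_in diff_conv_add_uminus minus_in)

lemma zero_in [simp]: "0 \<in> U"
  by (metis diff_in diff_self id_in)

lemma commutator_in [simp]: "A \<in> U \<Longrightarrow> B \<in> U \<Longrightarrow> commutator A B \<in> U"
  by (simp add: commutator_def)

lemma is_adjoint_adj: "A \<in> U \<Longrightarrow> is_adjoint A (adj A)"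
  by (metis adj_eq ex_adjoint)

lemma adj_in [simp]: "A \<in> U \<Longrightarrow> adj A \<in> U"
  by (metis adj_eq ex_adjoint)

lemma adj_adj [simp]: "A \<in> U \<Longrightarrow> adj (adj A) = A"
  by (simp add: adj_eq is_adjoint_adj is_adjoint_sym)

lemma adj_commutator: "A \<in> U \<Longrightarrow> B \<in> U \<Longrightarrow> adj (commutator A B) = commutator (adj B) (adj A)"
  by (simp add: adj_eq is_adjoint_commutator is_adjoint_adj)

lemma adj_add: "A \<in> U \<Longrightarrow> B \<in> U \<Longrightarrow> adj (A + B) = adj A + adj B"
  by (simp add: adj_eq is_adjoint_add is_adjoint_adj)

lemma adj_diff: "A \<in> U \<Longrightarrow> B \<in> U \<Longrightarrow> adj (A - B) = adj A - adj B"
  by (simp add: adj_eq is_adjoint_diff is_adjoint_adj)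

lemma adj_op_scaleC: "A \<in> U \<Longrightarrow> adj (op_scaleC c A) = op_scaleC (cnj c) (adj A)"
  by (simp add: adj_eq is_adjoint_op_scaleC is_adjoint_adj)

lemma cinner_adj: "A \<in> U \<Longrightarrow> cinner (blinfun_apply A x) y = cinner x (blinfun_apply (adj A) y)"
  using is_adjoint_adj is_adjoint_def by blast

lemma cinner_adj': "A \<in> U \<Longrightarrow> cinner x (blinfun_apply A y) = cinner (blinfun_apply (adj A) x) y"
  by (simp add: cinner_adj)

text \<open>The form in which weak closedness is used, both for norm limits and for the final
  operator \<open>W\<close>.\<close>

lemma mem_if_strongly_approx:
  assumes W: "W \<in> bounded_operators"
    and approx: "\<And>X e. finite X \<Longrightarrow> e > 0 \<Longrightarrow>
      \<exists>A\<in>U. \<forall>x\<in>X. norm (blinfun_apply A x - blinfun_apply W x) < e"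
  shows "W \<in> U"
proof (rule ccontr)
  assume "W \<notin> U"
  have closed: "closedin weak_operator_topology U"
    using vn by (simp add: von_neumann_algebra_def)
  \<comment> \<open>The topology lives on \<open>bounded_operators\<close>, not on the whole type,
    so \<open>W\<close> must first be placed in its space; a subbasic set with
    \<open>S = UNIV\<close> does this.\<close>
  have "W \<in> {A \<in> bounded_operators. cinner (blinfun_apply A 0) 0 \<in> UNIV}"
    using W by simp
  then have "W \<in> topspace weak_operator_topology"
    unfolding weak_operator_topology_def topology_generated_by_topspace by blast
  with \<open>W \<notin> U\<close> have mem: "W \<in> topspace weak_operator_topology - U"
    by (rule DiffI[rotated])
  have "openin weak_operator_topology (topspace weak_operator_topology - U)"
    using closed unfolding closedin_def by (rule conjunct2)
  from weak_open_contains_strong_nbhd[OF this mem] obtain X e where "finite X" "e > 0" and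
    X: "\<And>A. A \<in> bounded_operators \<Longrightarrow> \<forall>x\<in>X. norm (blinfun_apply A x - blinfun_apply W x) < e
      \<Longrightarrow> A \<in> topspace weak_operator_topology - U"
    by (elim exE conjE) (rule that, blast+)
  obtain A where "A \<in> U" "\<forall>x\<in>X. norm (blinfun_apply A x - blinfun_apply W x) < e"
    using approx[OF \<open>finite X\<close> \<open>e > 0\<close>] by blast
  then show False
    using X bounded_op by blast
qed

lemma closed_U: "closed U"
  unfolding closed_sequential_limits
proof (intro allI impI)
  fix f W
  assume "(\<forall>n. f n \<in> U) \<and> f \<longlonglongrightarrow> W"
  then have fU: "\<And>n. f n \<in> U" and lim: "f \<longlonglongrightarrow> W" by auto
  have lim_apply: "(\<lambda>n. blinfun_apply (f n) x) \<longlonglongrightarrow> blinfun_apply W x" for x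
    by (intro blinfun.tendsto lim tendsto_const)
  show "W \<in> U"
  proof (rule mem_if_strongly_approx)
    have "blinfun_apply W (c *\<^sub>C x) = c *\<^sub>C blinfun_apply W x" for c x
    proof (rule LIMSEQ_unique[OF lim_apply])
      have "(\<lambda>n. c *\<^sub>C blinfun_apply (f n) x) \<longlonglongrightarrow> c *\<^sub>C blinfun_apply W x"
        by (intro bounded_linear.tendsto[OF bounded_linear_scaleC] lim_apply)
      moreover have "blinfun_apply (f n) (c *\<^sub>C x) = c *\<^sub>C blinfun_apply (f n) x" for n
        using bounded_op[OF fU[of n]] by (simp add: bounded_operators_def)
      ultimately show "(\<lambda>n. blinfun_apply (f n) (c *\<^sub>C x)) \<longlonglongrightarrow> c *\<^sub>C blinfun_apply W x"
        by simp
    qed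
    then show "W \<in> bounded_operators"
      by (simp add: bounded_operators_def)
    fix X :: "'h set" and e :: real assume "finite X" "e > 0"
    have "\<forall>\<^sub>F n in sequentially. \<forall>x\<in>X. norm (blinfun_apply (f n) x - blinfun_apply W x) < e"
    proof (rule eventually_ball_finite[OF \<open>finite X\<close>], rule ballI)
      fix x
      show "\<forall>\<^sub>F n in sequentially. norm (blinfun_apply (f n) x - blinfun_apply W x) < e"
        using tendstoD[OF lim_apply[of x] \<open>e > 0\<close>] by (simp only: dist_norm)
    qed
    then obtain n where "\<forall>x\<in>X. norm (blinfun_apply (f n) x - blinfun_apply W x) < e"
      using eventually_happens sequentially_bot by blast
    then show "\<exists>A\<in>U. \<forall>x\<in>X. norm (blinfun_apply A x - blinfun_apply W x) < e"
      using fU by blast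
  qed
qed

section \<open>The center and the absence of central nilpotents\<close>

lemma center_in: "z \<in> center U \<Longrightarrow> z \<in> U"
  by (simp add: center_def)

lemma center_comm: "z \<in> center U \<Longrightarrow> A \<in> U \<Longrightarrow> A o\<^sub>L z = z o\<^sub>L A"
  by (simp add: center_def)

lemma commutator_center: "z \<in> center U \<Longrightarrow> A \<in> U \<Longrightarrow> commutator z A = 0"
  and commutator_center': "z \<in> center U \<Longrightarrow> A \<in> U \<Longrightarrow> commutator A z = 0"
  by (simp_all add: center_def commutator_def)

lemma mem_centerI: "A \<in> U \<Longrightarrow> (\<And>B. B \<in> U \<Longrightarrow> commutator A B = 0) \<Longrightarrow> A \<in> center U"
  by (simp add: center_def commutator_def)

lemma center_add: "A \<in> center U \<Longrightarrow> B \<in> center U \<Longrightarrow> A + B \<in> center U"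
  by (rule mem_centerI) (auto simp: center_in commutator_center commutator.add_left)

lemma center_diff: "A \<in> center U \<Longrightarrow> B \<in> center U \<Longrightarrow> A - B \<in> center U"
  by (rule mem_centerI) (auto simp: center_in commutator_center commutator.diff_left)

lemma center_scaleC: "A \<in> center U \<Longrightarrow> op_scaleC c A \<in> center U"
  by (rule mem_centerI) (auto simp: center_in commutator_center commutator_op_scaleC_left bounded_op
      op_scaleC_zero)

lemma center_scaleR: "A \<in> center U \<Longrightarrow> r *\<^sub>R A \<in> center U"
  by (metis center_scaleC op_scaleC_of_real)

lemma center_comp: "A \<in> center U \<Longrightarrow> B \<in> center U \<Longrightarrow> A o\<^sub>L B \<in> center U"
  by (rule mem_centerI) (auto simp: center_in commutator_center commutator_comp_left)

lemma commutator_center_comp: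
  "z \<in> center U \<Longrightarrow> A \<in> U \<Longrightarrow> B \<in> U \<Longrightarrow> commutator (z o\<^sub>L A) B = z o\<^sub>L commutator A B"
  by (simp add: commutator_comp_left commutator_center)

lemma commutator_center_comp':
  "z \<in> center U \<Longrightarrow> A \<in> U \<Longrightarrow> B \<in> U \<Longrightarrow> commutator B (z o\<^sub>L A) = z o\<^sub>L commutator B A"
  by (simp add: commutator_comp_right commutator_center')

text \<open>A central element commutes with its adjoint, so \<open>z\<close> annihilates
  \<open>y = (adj z) z h\<close>. Two uses of
  \<open>(norm (A x))\<^sup>2 = cinner ((adj A) (A x)) x\<close> give first \<open>y = 0\<close> and
  then \<open>z h = 0\<close>.\<close>

lemma central_square_zero:
  assumes z: "z \<in> center U" and sq: "z o\<^sub>L z = 0"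
  shows "z = 0"
proof (rule blinfun_eqI)
  fix h
  have zU: "z \<in> U" using z by (rule center_in)
  have norm_adj: "(norm (blinfun_apply A x))\<^sup>2 = Re (cinner (blinfun_apply (adj A) (blinfun_apply A x)) x)"
    if "A \<in> U" for A x
    using that by (simp only: Re_cinner_self[symmetric] cinner_adj'[symmetric])
  define y where "y = blinfun_apply (adj z) (blinfun_apply z h)"
  have "blinfun_apply z y = blinfun_apply ((z o\<^sub>L adj z) o\<^sub>L z) h"
    by (simp add: y_def)
  also have "\<dots> = blinfun_apply (adj z) (blinfun_apply (z o\<^sub>L z) h)"
    using center_comm[OF z adj_in[OF zU]] by (metis blinfun_apply_blinfun_compose)
  finally have "blinfun_apply z y = 0"
    using sq by (simp add: blinfun.zero_right)
  moreover have "(norm y)\<^sup>2 = Re (cinner (blinfun_apply z y) (blinfun_apply z h))"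
    by (simp only: Re_cinner_self[symmetric] cinner_adj[OF zU]) (simp add: y_def)
  ultimately have "y = 0"
    by (simp add: cinner.zero_left)
  then show "blinfun_apply z h = blinfun_apply 0 h"
    using norm_adj[OF zU, of h] by (simp add: y_def cinner.zero_left)
qed

text \<open>Since \<open>[x, C x] = [x, C] x\<close>, both \<open>w = [x, C]\<close> and
  \<open>w x\<close> are central; commuting the latter with \<open>C\<close> gives
  \<open>w w = 0\<close>.\<close>

lemma central_if_commutators_central:
  assumes x: "x \<in> U" and central: "\<And>C. C \<in> U \<Longrightarrow> commutator x C \<in> center U"
  shows "x \<in> center U"
proof (rule mem_centerI[OF x])
  fix C assume C: "C \<in> U"
  let ?w = "commutator x C"
  have "commutator x (C o\<^sub>L x) = ?w o\<^sub>L x"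
    by (simp add: commutator_comp_right)
  then have "?w o\<^sub>L x \<in> center U"
    using central[of "C o\<^sub>L x"] C x by simp
  then have "?w o\<^sub>L ?w = 0"
    using commutator_center_comp[OF central[OF C] x C] commutator_center C by metis
  then show "?w = 0"
    using central_square_zero central C by blast
qed

text \<open>Merging the first two arguments shows inductively that every \<open>[y, C]\<close> is
  central, and the preceding lemma removes one bracket at a time.\<close>

lemma central_if_lie_poly_zero:
  assumes "y \<in> U" and "\<And>A. (\<And>i. A i \<in> U) \<Longrightarrow> lie_poly (Suc m) (A(1 := y)) = 0"
  shows "y \<in> center U"
  using assms
proof (induction m arbitrary: y)
  case 0
  from "0.prems"(2)[of "\<lambda>_. 0"] have "y = 0" by simp
  then show ?case by (simp add: center_def)
next
  case (Suc m)
  show ?case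
  proof (rule central_if_commutators_central[OF Suc.prems(1)])
    fix C assume C: "C \<in> U"
    show "commutator y C \<in> center U"
    proof (rule Suc.IH)
      fix A :: "nat \<Rightarrow> 'h \<Rightarrow>\<^sub>L 'h" assume A: "\<And>i. A i \<in> U"
      let ?A = "\<lambda>i. if i = 1 then y else if i = 2 then C else A (i - 1)"
      have "?A = ?A(1 := y)" by auto
      then have "lie_poly (Suc (Suc m)) ?A = 0"
        using Suc.prems(2)[of ?A] A C Suc.prems(1) by auto
      then show "lie_poly (Suc m) (A(1 := commutator y C)) = 0"
        by (simp only: lie_poly_merge)
    qed (use C Suc.prems in simp)
  qed
qed

end

section \<open>From Lie centralizers to commuting maps\<close>

context von_neumann
begin

text \<open>Swapping the first two arguments only changes the sign of \<open>p_n\<close>, so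
  \<open>T\<close> may be moved onto the second argument as well as onto the first. The difference
  of the two brackets is therefore killed by all further brackets.\<close>

lemma commuting_mod_center_of_lie_n_centralizer:
  assumes n: "n \<ge> 2"
    and T_in: "\<And>A. A \<in> U \<Longrightarrow> T A \<in> U"
    and cen: "\<And>A. (\<And>i. A i \<in> U) \<Longrightarrow> T (lie_poly n A) = lie_poly n (A(1 := T (A 1)))"
    and T_minus: "\<And>A. A \<in> U \<Longrightarrow> T (- A) = - T A"
    and A: "A \<in> U" and B: "B \<in> U"
  shows "commutator (T A) B - commutator A (T B) \<in> center U"
proof -
  obtain m where m: "n = Suc (Suc m)"
    using n by (metis add_2_eq_Suc le_Suc_ex)
  show ?thesis
  proof (rule central_if_lie_poly_zero[where m = m])
    fix C :: "nat \<Rightarrow> 'h \<Rightarrow>\<^sub>L 'h"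
    assume C: "\<And>i. C i \<in> U"
    define q where "q X = lie_poly (Suc m) (C(1 := X))" for X
    have q_diff: "q (X - Y) = q X - q Y" for X Y
      unfolding q_def by (rule lie_poly_first_diff)
    have q_minus: "q (- X) = - q X" for X
      using q_diff[of 0 X] q_diff[of 0 0] by simp
    have q_in: "q X \<in> U" if "X \<in> U" for X
    proof -
      have "lie_poly k D \<in> U" if "\<And>i. D i \<in> U" for k and D :: "nat \<Rightarrow> 'h \<Rightarrow>\<^sub>L 'h"
        using that by (induction k D rule: lie_poly.induct) auto
      then show ?thesis
        using that C unfolding q_def by auto
    qed
    have T_q: "T (q (commutator X Y)) = q (commutator (T X) Y)" if "X \<in> U" "Y \<in> U" for X Y
    proof -
      let ?D = "\<lambda>X i. if i = 1 then X else if i = 2 then Y else C (i - 1)"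
      have "T (lie_poly n (?D X)) = lie_poly n ((?D X)(1 := T (?D X 1)))"
        using that C by (intro cen) auto
      also have "(?D X)(1 := T (?D X 1)) = ?D (T X)"
        by auto
      finally show ?thesis
        unfolding q_def m lie_poly_merge .
    qed
    have "q (commutator A (T B)) = - q (commutator (T B) A)"
      by (simp only: commutator_swap[of A] q_minus)
    also have "\<dots> = - T (q (- commutator A B))"
      using A B by (simp only: T_q[symmetric] commutator_swap[of B])
    also have "\<dots> = T (q (commutator A B))"
      using A B by (simp add: q_minus T_minus q_in)
    also have "\<dots> = q (commutator (T A) B)"
      using A B by (rule T_q)
    finally show "lie_poly (Suc m) (C(1 := commutator (T A) B - commutator A (T B))) = 0"
      using q_diff unfolding q_def by simp
  qed (use A B T_in in simp)
qed

text \<open>To be read with \<open>P = T A\<close> and \<open>Q = T (A A)\<close>. Bracketing with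
  \<open>P\<close> sends \<open>A\<close> to the central \<open>z\<close>, so it lowers degrees of
  polynomials in \<open>A\<close> with central coefficients. The hypotheses make
  \<open>[Q, A A]\<close> the polynomial \<open>2 \<zeta> A - 4 z A A\<close>; it is central, so
  bracketing twice with \<open>P\<close> leaves \<open>8 z z z = 0\<close>.\<close>

lemma centralizing_at_square_imp_commuting:
  assumes A: "A \<in> U" and P: "P \<in> U" and Q: "Q \<in> U"
    and PA: "commutator P A \<in> center U"
    and diff: "commutator P (A o\<^sub>L A) - commutator A Q \<in> center U"
    and QA: "commutator Q (A o\<^sub>L A) \<in> center U"
  shows "commutator P A = 0"
proof -
  define z \<zeta> where "z = commutator P A" and "\<zeta> = commutator P (A o\<^sub>L A) - commutator A Q"
  have z: "z \<in> center U" and \<zeta>: "\<zeta> \<in> center U"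
    using PA diff by (simp_all add: z_def \<zeta>_def)
  have zU: "z \<in> U" and \<zeta>U: "\<zeta> \<in> U"
    using z \<zeta> by (simp_all add: center_in)
  have PAA: "commutator P (A o\<^sub>L A) = 2 *\<^sub>R (z o\<^sub>L A)"
    using center_comm[OF z A] by (simp add: commutator_comp_right scaleR_2 flip: z_def)
  have QA': "commutator Q A = \<zeta> - 2 *\<^sub>R (z o\<^sub>L A)"
    using PAA commutator_swap[of Q A] by (simp add: \<zeta>_def)
  have "commutator Q (A o\<^sub>L A) = 2 *\<^sub>R (\<zeta> o\<^sub>L A) - 4 *\<^sub>R (z o\<^sub>L (A o\<^sub>L A))"
  proof -
    have "A o\<^sub>L (z o\<^sub>L A) = z o\<^sub>L (A o\<^sub>L A)"
      by (metis blinfun_compose_assoc center_comm z A)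
    then show ?thesis
      using center_comm[OF \<zeta> A]
      by (simp add: commutator_comp_right QA' comp_simps) (simp add: algebra_simps flip: scaleR_2)
  qed
  then have R: "2 *\<^sub>R (\<zeta> o\<^sub>L A) - 4 *\<^sub>R (z o\<^sub>L (A o\<^sub>L A)) \<in> center U" (is "?R \<in> _")
    using QA by simp
  have "0 = commutator P ?R"
    using R P by (simp add: commutator_center')
  also have "\<dots> = 2 *\<^sub>R (\<zeta> o\<^sub>L z) - 8 *\<^sub>R (z o\<^sub>L (z o\<^sub>L A))"
    using A P by (simp add: commutator.diff_right commutator.scaleR_right commutator_center_comp' z \<zeta>
        PAA comp_simps flip: z_def)
  finally have "commutator P (2 *\<^sub>R (\<zeta> o\<^sub>L z) - 8 *\<^sub>R (z o\<^sub>L (z o\<^sub>L A))) = 0"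
    by (simp add: commutator.zero_right flip: \<open>0 = commutator P ?R\<close>)
  moreover have "commutator P (2 *\<^sub>R (\<zeta> o\<^sub>L z) - 8 *\<^sub>R (z o\<^sub>L (z o\<^sub>L A))) = - 8 *\<^sub>R (z o\<^sub>L (z o\<^sub>L z))"
    using A P zU by (simp add: commutator.diff_right commutator.scaleR_right commutator_center_comp'
        commutator_center' z \<zeta> flip: z_def)
  ultimately have "z o\<^sub>L (z o\<^sub>L z) = 0"
    by simp
  \<comment> \<open>Passing from the third to the fourth power allows
    \<open>central_square_zero\<close> to be applied twice.\<close>
  then have "(z o\<^sub>L z) o\<^sub>L (z o\<^sub>L z) = 0"
    by (simp add: blinfun_compose_assoc)
  then have "z o\<^sub>L z = 0"
    using central_square_zero center_comp z by blast
  then show ?thesis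
    using central_square_zero z by (simp add: z_def)
qed

text \<open>With both arguments equal to \<open>X\<close> the hypothesis says that
  \<open>2 [T X, X]\<close> is central; using it also at the square of \<open>X\<close> upgrades
  this to \<open>[T X, X] = 0\<close>, and polarization finishes.\<close>

lemma commuting_if_commuting_mod_center:
  assumes T_in: "\<And>A. A \<in> U \<Longrightarrow> T A \<in> U"
    and T_add: "\<And>A B. A \<in> U \<Longrightarrow> B \<in> U \<Longrightarrow> T (A + B) = T A + T B"
    and cen: "\<And>A B. A \<in> U \<Longrightarrow> B \<in> U \<Longrightarrow> commutator (T A) B - commutator A (T B) \<in> center U"
    and A: "A \<in> U" and B: "B \<in> U"
  shows "commutator (T A) B = commutator A (T B)"
proof -
  have self_central: "commutator (T X) X \<in> center U" if "X \<in> U" for X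
  proof -
    have "commutator (T X) X = (1/2) *\<^sub>R (commutator (T X) X - commutator X (T X))"
      using commutator_swap[of X "T X"] by (simp flip: scaleR_2)
    then show ?thesis
      using cen[OF that that] center_scaleR by metis
  qed
  have self: "commutator (T X) X = 0" if X: "X \<in> U" for X
    by (rule centralizing_at_square_imp_commuting[of X "T X" "T (X o\<^sub>L X)"])
      (use X T_in cen self_central in auto)
  have "0 = commutator (T (A + B)) (A + B)"
    using self A B by simp
  also have "\<dots> = commutator (T A) B + commutator (T B) A"
    using self A B by (simp add: T_add commutator.add_left commutator.add_right)
  finally show ?thesis
    using commutator_swap[of A "T B"] by (metis add.left_inverse add_right_cancel)
qed

end

section \<open>Continuity of commuting maps modulo the center\<close>

locale commuting_map = von_neumann U
  for U :: "('h::complex_hilbert_space \<Rightarrow>\<^sub>L 'h) set" +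
  fixes T :: "('h \<Rightarrow>\<^sub>L 'h) \<Rightarrow> ('h \<Rightarrow>\<^sub>L 'h)"
  assumes T_in [simp]: "A \<in> U \<Longrightarrow> T A \<in> U"
    and T_add: "A \<in> U \<Longrightarrow> B \<in> U \<Longrightarrow> T (A + B) = T A + T B"
    and T_scaleR: "A \<in> U \<Longrightarrow> T (r *\<^sub>R A) = r *\<^sub>R T A"
    and commuting: "A \<in> U \<Longrightarrow> B \<in> U \<Longrightarrow> commutator (T A) B = commutator A (T B)"
begin

lemma T_diff: "A \<in> U \<Longrightarrow> B \<in> U \<Longrightarrow> T (A - B) = T A - T B"
  using T_add[of A "- B"] T_scaleR[of B "-1"] by simp

lemma T_center: "z \<in> center U \<Longrightarrow> T z \<in> center U"
  by (rule mem_centerI) (simp_all add: center_in commuting commutator_center)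

text \<open>Baire's theorem in the norm closed set \<open>U\<close>: the sets \<open>B m\<close>
  exhaust \<open>U\<close>, so the closure of one of them has interior. As \<open>B m\<close> need
  not be closed, the bound is obtained only at points \<open>x'\<close> arbitrarily near to
  \<open>x\<close>.\<close>

lemma dense_bound_mod_center:
  obtains C where "C \<ge> 0" and
    "\<And>x d. x \<in> U \<Longrightarrow> d > 0 \<Longrightarrow>
      \<exists>x'\<in>U. \<exists>z\<in>center U. norm (x - x') < d \<and> norm (T x' - z) \<le> C * norm x"
proof -
  define B where "B m = {x \<in> U. \<exists>z\<in>center U. norm (T x - z) \<le> real m}" for m :: nat
  have "\<exists>m. top_of_set U interior_of closure (B m) \<noteq> {}"
  proof (rule ccontr)
    assume empty: "\<not> ?thesis"
    have B_sub: "closure (B m) \<subseteq> U" for m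
      using closed_U by (intro closure_minimal) (auto simp: B_def)
    have "top_of_set U interior_of \<Union>(range (\<lambda>m. closure (B m))) = {}"
    proof (rule Baire_category_alt)
      show "completely_metrizable_space (top_of_set U) \<or>
          locally_compact_space (top_of_set U) \<and> regular_space (top_of_set U)"
        using closed_U unfolding closed_closedin
        by (intro disjI1 completely_metrizable_space_closedin completely_metrizable_space_euclidean)
      show "closedin (top_of_set U) S \<and> top_of_set U interior_of S = {}"
        if "S \<in> range (\<lambda>m. closure (B m))" for S
        using that empty closed_subset[OF B_sub closed_closure] by auto
    qed simp
    moreover have "\<Union>(range (\<lambda>m. closure (B m))) = U"
    proof
      show "U \<subseteq> \<Union>(range (\<lambda>m. closure (B m)))"
      proof
        fix x assume "x \<in> U"
        moreover obtain m where "norm (T x) \<le> real m"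
          using real_arch_simple by blast
        moreover have "0 \<in> center U" by (simp add: center_def)
        ultimately have "x \<in> B m"
          unfolding B_def by (auto intro!: bexI[of _ 0])
        then show "x \<in> \<Union>(range (\<lambda>m. closure (B m)))"
          using closure_subset by blast
      qed
    qed (use B_sub in blast)
    ultimately have "top_of_set U interior_of U = {}" by simp
    moreover have "top_of_set U interior_of U = U"
      by (metis interior_of_topspace topspace_euclidean_subtopology)
    ultimately show False
      using zero_in by blast
  qed
  then obtain m x0 where "x0 \<in> top_of_set U interior_of closure (B m)"
    by blast
  then obtain V where V: "open V" "x0 \<in> V" "x0 \<in> U" "U \<inter> V \<subseteq> closure (B m)"
    unfolding interior_of_def openin_open by blast
  then obtain r where r: "r > 0" "ball x0 r \<subseteq> V"
    using open_contains_ball by blast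
  \<comment> \<open>Writing \<open>x\<close> as half the difference of \<open>x0 + x\<close> and
    \<open>x0 - x\<close> moves the ball from \<open>x0\<close> to the origin without worsening the
    bound \<open>m\<close>.\<close>
  have near: "\<exists>x'\<in>U. \<exists>z\<in>center U. norm (x - x') < d \<and> norm (T x' - z) \<le> real m"
    if x: "x \<in> U" "norm x < r" and d: "d > 0" for x d
  proof -
    have "x0 + x \<in> ball x0 r" "x0 - x \<in> ball x0 r"
      using x by (simp_all add: dist_norm)
    then have "x0 + x \<in> closure (B m)" "x0 - x \<in> closure (B m)"
      using V(3,4) r(2) x(1) by (auto intro!: subsetD[OF V(4)] simp del: mem_ball)
    then obtain a b where a: "a \<in> B m" "norm (a - (x0 + x)) < d"
      and b: "b \<in> B m" "norm (b - (x0 - x)) < d"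
      using d unfolding closure_approachable dist_norm by blast
    then obtain y z where yz: "y \<in> center U" "norm (T a - y) \<le> m" "z \<in> center U" "norm (T b - z) \<le> m"
      and ab: "a \<in> U" "b \<in> U"
      by (auto simp: B_def)
    show ?thesis
    proof (intro bexI conjI)
      show "norm (x - (1/2) *\<^sub>R (a - b)) < d"
      proof -
        have "x - (1/2) *\<^sub>R (a - b) = (1/2) *\<^sub>R ((b - (x0 - x)) - (a - (x0 + x)))"
          by (simp add: algebra_simps flip: scaleR_left.add)
        then have "norm (x - (1/2) *\<^sub>R (a - b)) = (1/2) * norm ((b - (x0 - x)) - (a - (x0 + x)))"
          by simp
        also have "\<dots> \<le> (1/2) * (norm (b - (x0 - x)) + norm (a - (x0 + x)))"
          by (intro mult_left_mono norm_triangle_ineq4) simp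
        finally show ?thesis
          using a b by simp
      qed
      show "norm (T ((1/2) *\<^sub>R (a - b)) - (1/2) *\<^sub>R (y - z)) \<le> m"
      proof -
        have "T ((1/2) *\<^sub>R (a - b)) - (1/2) *\<^sub>R (y - z) = (1/2) *\<^sub>R ((T a - y) - (T b - z))"
          using ab by (simp add: T_scaleR T_diff algebra_simps)
        then have "norm (T ((1/2) *\<^sub>R (a - b)) - (1/2) *\<^sub>R (y - z))
            = (1/2) * norm ((T a - y) - (T b - z))"
          by simp
        also have "\<dots> \<le> (1/2) * (norm (T a - y) + norm (T b - z))"
          by (intro mult_left_mono norm_triangle_ineq4) simp
        finally show ?thesis
          using yz by simp
      qed
    qed (use ab yz center_diff center_scaleR in auto)
  qed
  show thesis
  proof (rule that)
    show "0 \<le> 2 * m / r" using r by simp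
    fix x d assume x: "x \<in> U" and d: "(d::real) > 0"
    show "\<exists>x'\<in>U. \<exists>z\<in>center U. norm (x - x') < d \<and> norm (T x' - z) \<le> 2 * m / r * norm x"
    proof (cases "x = 0")
      case True
      have "T 0 = 0" using T_diff[of 0 0] by simp
      with True d show ?thesis
        by (intro bexI[of _ 0]) (auto simp: center_def)
    next
      case False
      \<comment> \<open>Scales \<open>x\<close> to norm \<open>r / 2\<close>, inside the ball;
        undoing this multiplies \<open>m\<close> by \<open>2 * norm x / r\<close>.\<close>
      define s where "s = r / (2 * norm x)"
      have s: "s > 0" using False r by (simp add: s_def)
      have "norm (s *\<^sub>R x) < r"
        using False r by (simp add: s_def)
      then obtain y z where y: "y \<in> U" and z: "z \<in> center U"
        and yz: "norm (s *\<^sub>R x - y) < s * d" "norm (T y - z) \<le> m"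
        using near[of "s *\<^sub>R x" "s * d"] x s d by auto
      show ?thesis
      proof (intro bexI conjI)
        have "x - inverse s *\<^sub>R y = inverse s *\<^sub>R (s *\<^sub>R x - y)"
          using s by (simp add: scaleR_diff_right)
        then have "norm (x - inverse s *\<^sub>R y) = inverse s * norm (s *\<^sub>R x - y)"
          using s by simp
        also have "\<dots> < inverse s * (s * d)"
          using s yz by (intro mult_strict_left_mono) auto
        also have "\<dots> = d"
          using s by (simp add: mult.assoc[symmetric])
        finally show "norm (x - inverse s *\<^sub>R y) < d" .
        have "T (inverse s *\<^sub>R y) - inverse s *\<^sub>R z = inverse s *\<^sub>R (T y - z)"
          using y by (simp add: T_scaleR scaleR_diff_right)
        then have "norm (T (inverse s *\<^sub>R y) - inverse s *\<^sub>R z) = inverse s * norm (T y - z)"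
          using s by simp
        also have "\<dots> \<le> inverse s * m"
          using s yz by (intro mult_left_mono) auto
        also have "\<dots> = 2 * m / r * norm x"
          by (simp add: s_def)
        finally show "norm (T (inverse s *\<^sub>R y) - inverse s *\<^sub>R z) \<le> 2 * m / r * norm x" .
      qed (use y z center_scaleR in auto)
    qed
  qed
qed

text \<open>A closed graph argument in \<open>U / center U\<close>: the dense bound is upgraded by successive
  approximation, the commutation identity playing the role of the closed graph.\<close>

lemma bounded_mod_center:
  obtains C where "C \<ge> 0" and "\<And>x. x \<in> U \<Longrightarrow> \<exists>z\<in>center U. norm (T x - z) \<le> C * norm x"
proof -
  obtain C where C: "C \<ge> 0" and
    dense: "\<And>x d. x \<in> U \<Longrightarrow> d > 0 \<Longrightarrow>
      \<exists>x'\<in>U. \<exists>z\<in>center U. norm (x - x') < d \<and> norm (T x' - z) \<le> C * norm x"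
    by (rule dense_bound_mod_center) blast
  from dense have "\<forall>x d. \<exists>x' z. x \<in> U \<and> d > 0 \<longrightarrow>
      x' \<in> U \<and> z \<in> center U \<and> norm (x - x') < d \<and> norm (T x' - z) \<le> C * norm x"
    by blast
  then obtain g k where gk: "x \<in> U \<Longrightarrow> d > 0 \<Longrightarrow>
      g x d \<in> U \<and> k x d \<in> center U \<and> norm (x - g x d) < d \<and> norm (T (g x d) - k x d) \<le> C * norm x"
    for x d
    unfolding choice_iff by blast
  have "\<exists>z\<in>center U. norm (T x - z) \<le> 2 * C * norm x" if x: "x \<in> U" for x
  proof (cases "x = 0")
    case True
    have "T 0 = 0" using T_diff[of 0 0] by simp
    with True show ?thesis by (intro bexI[of _ 0]) (auto simp: center_def)
  next
    case False
    define a where "a = norm x"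
    have a: "a > 0" using False by (simp add: a_def)
    \<comment> \<open>The remainders after subtracting successive approximants. The tolerances
      halve, so the corrections \<open>ys\<close> are bounded by \<open>C * a * (1/2) ^ n\<close>,
      whose sum is the claimed \<open>2 * C * a\<close>.\<close>
    define r where "r = rec_nat x (\<lambda>n y. y - g y (a * (1/2) ^ Suc n))"
    have r0: "r 0 = x" and rS: "\<And>n. r (Suc n) = r n - g (r n) (a * (1/2) ^ Suc n)"
      by (simp_all add: r_def)
    have rU: "r n \<in> U" for n
    proof (induction n)
      case (Suc n)
      then show ?case
        using gk[OF Suc, of "a * (1/2) ^ Suc n"] a by (simp add: rS)
    qed (simp add: r0 x)
    have r_norm: "norm (r n) \<le> a * (1/2) ^ n" for n
    proof (cases n)
      case (Suc m)
      then show ?thesis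
        using gk[OF rU, of "a * (1/2) ^ Suc m"] a by (simp add: rS less_imp_le)
    qed (simp add: r0 a_def)
    define xs where "xs n = g (r n) (a * (1/2) ^ Suc n)" for n
    define zs where "zs n = k (r n) (a * (1/2) ^ Suc n)" for n
    define ys where "ys n = T (xs n) - zs n" for n
    have pos: "a * (1/2) ^ Suc n > 0" for n
      using a by simp
    have xsU: "xs n \<in> U" for n
      using gk[OF rU pos] by (simp add: xs_def)
    have zsZ: "zs n \<in> center U" for n
      using gk[OF rU pos] by (simp add: zs_def)
    have ysU: "ys n \<in> U" for n
      by (simp add: ys_def xsU center_in[OF zsZ])
    have ys_norm: "norm (ys n) \<le> C * a * (1/2) ^ n" for n
    proof -
      have "norm (ys n) \<le> C * norm (r n)"
        using gk[OF rU pos] by (simp add: ys_def xs_def zs_def)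
      also have "\<dots> \<le> C * (a * (1/2) ^ n)"
        by (intro mult_left_mono r_norm C)
      finally show ?thesis by simp
    qed
    have geo: "(\<lambda>n. C * a * (1/2) ^ n) sums (C * a * 2)"
      using sums_mult[OF geometric_sums[of "1/2::real"], of "C * a"] by simp
    have summable: "summable ys"
      by (rule summable_comparison_test'[OF sums_summable[OF geo], of 0]) (use ys_norm in simp)
    define y where "y = suminf ys"
    have ys_sums: "ys sums y"
      using summable by (simp add: y_def summable_sums)
    have yU: "y \<in> U"
    proof (rule closed_sequentially[OF closed_U])
      show "(\<Sum>i<n. ys i) \<in> U" for n
        by (induction n) (use ysU in auto)
      show "(\<lambda>n. \<Sum>i<n. ys i) \<longlonglongrightarrow> y"
        using ys_sums by (simp add: sums_def)
    qed
    have y_norm: "norm y \<le> 2 * C * a"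
      using norm_suminf_le[OF ys_norm sums_summable[OF geo]] sums_unique[OF geo]
      by (simp add: y_def mult_ac)
    have xs_sums: "xs sums x"
    proof -
      have part: "(\<Sum>i<n. xs i) = x - r n" for n
        by (induction n) (simp_all add: r0 rS xs_def)
      have "r \<longlonglongrightarrow> 0"
      proof (rule Lim_null_comparison[where g = "\<lambda>n. a * (1/2) ^ n"])
        show "(\<lambda>n. a * (1/2) ^ n) \<longlonglongrightarrow> 0"
          by (intro tendsto_mult_right_zero LIMSEQ_power_zero) simp
      qed (use r_norm in simp)
      then have "(\<lambda>n. x - r n) \<longlonglongrightarrow> x - 0"
        by (intro tendsto_diff tendsto_const)
      then show ?thesis
        by (simp add: sums_def part)
    qed
    \<comment> \<open>The series for \<open>x\<close> cannot be passed through \<open>T\<close>.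
      Inside a bracket \<open>T\<close> can be shifted to the fixed \<open>b\<close>, and then only
      continuity of the commutator is needed.\<close>
    have "commutator (T x - y) b = 0" if b: "b \<in> U" for b
    proof -
      have "(\<lambda>n. commutator (ys n) b) sums commutator y b"
        by (rule bounded_linear.sums[OF commutator.bounded_linear_left ys_sums])
      moreover have "commutator (ys n) b = commutator (xs n) (T b)" for n
        using zsZ xsU b by (simp add: ys_def commutator.diff_left commutator_center commuting)
      moreover have "(\<lambda>n. commutator (xs n) (T b)) sums commutator x (T b)"
        by (rule bounded_linear.sums[OF commutator.bounded_linear_left xs_sums])
      ultimately have "commutator y b = commutator x (T b)"
        using sums_unique2 by simp
      then show ?thesis
        using x b by (simp add: commutator.diff_left commuting)
    qed
    then have "T x - y \<in> center U"
      using x yU by (intro mem_centerI) auto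
    then show ?thesis
      using y_norm by (intro bexI[of _ "T x - y"]) (simp_all add: a_def)
  qed
  then show thesis
    using C by (intro that[of "2 * C"]) auto
qed

lemma iterate_in: "x \<in> U \<Longrightarrow> (T ^^ n) x \<in> U"
  by (induction n) auto

text \<open>As \<open>T\<close> preserves the center, \<open>T ^^ n\<close> is still bounded modulo
  the center, with constant \<open>C ^ n\<close>; the central part does not show in a
  commutator.\<close>

lemma iterated_commutator_bound:
  obtains C where "C > 0" and
    "\<And>x y n. x \<in> U \<Longrightarrow> y \<in> U \<Longrightarrow> norm (commutator ((T ^^ n) x) y) \<le> 2 * C ^ n * norm x * norm y"
proof -
  obtain C0 where "C0 \<ge> 0" and C0: "\<And>x. x \<in> U \<Longrightarrow> \<exists>z\<in>center U. norm (T x - z) \<le> C0 * norm x"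
    by (rule bounded_mod_center) blast
  \<comment> \<open>The summand 1 makes \<open>C\<close> strictly positive, as
    \<open>log_convex_first_step\<close> requires.\<close>
  define C where "C = C0 + 1"
  have C: "C > 0" using \<open>C0 \<ge> 0\<close> by (simp add: C_def)
  have bound: "\<exists>w\<in>U. norm w \<le> C ^ n * norm x \<and> (T ^^ n) x - w \<in> center U" if x: "x \<in> U" for x n
  proof (induction n)
    case 0
    show ?case using x by (intro bexI[of _ x]) (auto simp: center_def)
  next
    case (Suc n)
    then obtain w where w: "w \<in> U" "norm w \<le> C ^ n * norm x" "(T ^^ n) x - w \<in> center U"
      by blast
    obtain z where z: "z \<in> center U" "norm (T w - z) \<le> C0 * norm w"
      using C0 w by blast
    have "norm (T w - z) \<le> C * norm w"
      using z(2) by (simp add: C_def distrib_right add_increasing2)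
    also have "\<dots> \<le> C * (C ^ n * norm x)"
      using w C by (intro mult_left_mono) auto
    finally have "norm (T w - z) \<le> C ^ Suc n * norm x" by simp
    moreover have eq: "(T ^^ Suc n) x - (T w - z) = T ((T ^^ n) x - w) + z"
      using w iterate_in[OF x] by (simp add: T_diff)
    have "(T ^^ Suc n) x - (T w - z) \<in> center U"
      unfolding eq by (rule center_add[OF T_center[OF w(3)] z(1)])
    ultimately show ?case
      using w z center_in by (intro bexI[of _ "T w - z"]) auto
  qed
  show thesis
  proof (rule that[OF C])
    fix x y n assume x: "x \<in> U" and y: "y \<in> U"
    obtain w where w: "w \<in> U" "norm w \<le> C ^ n * norm x" "(T ^^ n) x - w \<in> center U"
      using bound[OF x] by blast
    have "commutator ((T ^^ n) x) y = commutator w y"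
      using commutator_center[OF w(3) y] by (simp add: commutator.diff_left)
    also have "norm \<dots> \<le> 2 * norm w * norm y"
      by (rule norm_commutator_le)
    also have "\<dots> \<le> 2 * (C ^ n * norm x) * norm y"
      using w by (intro mult_right_mono mult_left_mono) auto
    finally show "norm (commutator ((T ^^ n) x) y) \<le> 2 * C ^ n * norm x * norm y"
      by (simp add: mult_ac)
  qed
qed

end

section \<open>The implementing central element\<close>

lemma subspace_closure:
  fixes S :: "'a::real_normed_vector set"
  assumes "subspace S"
  shows "subspace (closure S)"
proof (rule subspaceI)
  show "0 \<in> closure S"
    using assms closure_subset subspace_0 by blast
  show "x + y \<in> closure S" if x: "x \<in> closure S" and y: "y \<in> closure S" for x y
  proof -
    obtain f where "\<forall>n. f n \<in> S" "f \<longlonglongrightarrow> x"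
      using x unfolding closure_sequential by blast
    moreover obtain g where "\<forall>n. g n \<in> S" "g \<longlonglongrightarrow> y"
      using y unfolding closure_sequential by blast
    ultimately have "\<forall>n. f n + g n \<in> S" "(\<lambda>n. f n + g n) \<longlonglongrightarrow> x + y"
      using assms by (auto intro: subspace_add tendsto_add)
    then show ?thesis
      unfolding closure_sequential by (intro exI[of _ "\<lambda>n. f n + g n"] conjI)
  qed
  show "c *\<^sub>R x \<in> closure S" if "x \<in> closure S" for c x
  proof -
    have "(*\<^sub>R) c ` closure S \<subseteq> closure ((*\<^sub>R) c ` S)"
      by (rule closure_bounded_linear_image_subset[OF bounded_linear_scaleR_right])
    also have "\<dots> \<subseteq> closure S"
      using assms by (intro closure_mono) (auto intro: subspace_scale)
    finally show ?thesis
      using that by blast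
  qed
qed

text \<open>The ratios of consecutive terms do not decrease. A first ratio above \<open>C\<close>
  would force growth faster than \<open>K * C ^ n\<close>, whatever \<open>K\<close> is; this
  independence from \<open>K\<close> is what later yields a uniform bound.\<close>

lemma log_convex_first_step:
  fixes a :: "nat \<Rightarrow> real"
  assumes C: "C > 0" and nonneg: "\<And>n. a n \<ge> 0"
    and convex: "\<And>n. (a (Suc n))\<^sup>2 \<le> a n * a (Suc (Suc n))"
    and growth: "\<And>n. a n \<le> K * C ^ n"
  shows "a 1 \<le> C * a 0"
proof (rule ccontr)
  assume "\<not> ?thesis"
  then have less: "C * a 0 < a 1" by simp
  have a0: "a 0 > 0"
  proof (rule ccontr)
    assume "\<not> a 0 > 0"
    then have "a 0 = 0" using nonneg[of 0] by simp
    then have "a 1 = 0" using convex[of 0] by simp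
    with less \<open>a 0 = 0\<close> show False by simp
  qed
  define r where "r = a 1 / a 0"
  have r: "r > C" using less a0 by (simp add: r_def pos_less_divide_eq)
  have ratio: "a n > 0 \<and> a (Suc n) \<ge> r * a n" for n
  proof (induction n)
    case (Suc n)
    have "r * a n > 0" using Suc r C by simp
    then have pos: "a (Suc n) > 0" using Suc by linarith
    have "a n * (r * a (Suc n)) = (r * a n) * a (Suc n)" by simp
    also have "\<dots> \<le> a (Suc n) * a (Suc n)"
      using Suc pos by (intro mult_right_mono) auto
    also have "\<dots> \<le> a n * a (Suc (Suc n))"
      using convex[of n] by (simp add: power2_eq_square)
    finally show ?case
      using pos Suc by simp
  qed (use a0 in \<open>simp add: r_def\<close>)
  have power: "r ^ n * a 0 \<le> a n" for n
  proof (induction n)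
    case (Suc n)
    have "r ^ Suc n * a 0 \<le> r * a n"
      using Suc r C by (simp add: mult.assoc)
    then show ?case using ratio[of n] by linarith
  qed simp
  obtain n where n: "K / a 0 < (r / C) ^ n"
    using real_arch_pow[of "r / C"] r C by auto
  have "r ^ n * a 0 \<le> K * C ^ n"
    using power growth order_trans by blast
  then have "(r / C) ^ n \<le> K / a 0"
    using C a0 by (simp add: power_divide pos_divide_le_eq pos_le_divide_eq field_simps)
  with n show False by simp
qed

text \<open>Expanding the square gives \<open>-2 (norm (d v))\<^sup>2 / s\<close> from the cross
  term, and at most half of it is lost again because
  \<open>(norm c)\<^sup>2 \<le> s\<close>.\<close>

lemma norm_sq_sub_compose:
  assumes adj: "is_adjoint c d" and s: "s > 0" "(norm c)\<^sup>2 \<le> s"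
  shows "(norm (v - (1 / s) *\<^sub>R blinfun_apply c (blinfun_apply d v)))\<^sup>2
    \<le> (norm v)\<^sup>2 - (norm (blinfun_apply d v))\<^sup>2 / s"
proof -
  define u where "u = blinfun_apply d v"
  have "cinner v (blinfun_apply c u) = cinner u u"
    using is_adjoint_sym[OF adj] by (simp add: is_adjoint_def u_def)
  then have "(norm (v - (1 / s) *\<^sub>R blinfun_apply c u))\<^sup>2
      = (norm v)\<^sup>2 - 2 * (norm u)\<^sup>2 / s + (norm (blinfun_apply c u))\<^sup>2 / s\<^sup>2"
    using s by (simp add: norm_diff_sq cinner_scaleR_right cinner_self power_divide)
  also have "(norm (blinfun_apply c u))\<^sup>2 \<le> s * (norm u)\<^sup>2"
  proof -
    have "(norm (blinfun_apply c u))\<^sup>2 \<le> (norm c * norm u)\<^sup>2"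
      by (intro power_mono norm_blinfun) simp
    also have "\<dots> \<le> s * (norm u)\<^sup>2"
      using s by (simp add: power_mult_distrib mult_right_mono)
    finally show ?thesis .
  qed
  then have "(norm (blinfun_apply c u))\<^sup>2 / s\<^sup>2 \<le> (norm u)\<^sup>2 / s"
    using s by (simp add: power2_eq_square field_simps)
  finally show ?thesis
    by (simp add: u_def)
qed

text \<open>Each step \<open>u \<mapsto> u - d (c u) / s\<close> decreases \<open>\<parallel>u\<parallel>\<^sup>2\<close> by at least \<open>\<parallel>c u\<parallel>\<^sup>2 / s\<close>,
  and \<open>c\<close> intertwines it with the step for \<open>c d\<close>.\<close>

lemma damping_iterates:
  assumes adj: "is_adjoint c d" and s: "s > 0" "(norm d)\<^sup>2 \<le> s" and e: "e > 0"
  shows "\<exists>N. norm (((\<lambda>v. v - (1 / s) *\<^sub>R blinfun_apply c (blinfun_apply d v)) ^^ N)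
    (blinfun_apply c h)) < e"
proof (rule ccontr)
  let ?B = "\<lambda>v. v - (1 / s) *\<^sub>R blinfun_apply c (blinfun_apply d v)"
  let ?D = "\<lambda>u. u - (1 / s) *\<^sub>R blinfun_apply d (blinfun_apply c u)"
  assume "\<not> ?thesis"
  then have far: "norm ((?B ^^ N) (blinfun_apply c h)) \<ge> e" for N
    by (simp add: not_less)
  have inter: "(?B ^^ N) (blinfun_apply c h) = blinfun_apply c ((?D ^^ N) h)" for N
    by (induction N) (simp_all add: blinfun.diff_right blinfun.scaleR_right)
  \<comment> \<open>If no iterate became small, every step would use up at least
    \<open>e\<^sup>2 / s\<close> of the finite budget \<open>(norm h)\<^sup>2\<close>.\<close>
  have "(norm ((?D ^^ N) h))\<^sup>2 \<le> (norm h)\<^sup>2 - real N * (e\<^sup>2 / s)" for N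
  proof (induction N)
    case (Suc N)
    have "e\<^sup>2 \<le> (norm (blinfun_apply c ((?D ^^ N) h)))\<^sup>2"
      using far[of N] e unfolding inter by (intro power_mono) auto
    then have "e\<^sup>2 / s \<le> (norm (blinfun_apply c ((?D ^^ N) h)))\<^sup>2 / s"
      using s by (intro divide_right_mono) auto
    moreover have "(norm ((?D ^^ Suc N) h))\<^sup>2
        \<le> (norm ((?D ^^ N) h))\<^sup>2 - (norm (blinfun_apply c ((?D ^^ N) h)))\<^sup>2 / s"
      using norm_sq_sub_compose[OF is_adjoint_sym[OF adj] s] by simp
    ultimately show ?case
      using Suc unfolding of_nat_Suc distrib_right mult_1 by linarith
  qed simp
  then have "real N * (e\<^sup>2 / s) \<le> (norm h)\<^sup>2" for N
    by (smt (verit) zero_le_power2)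
  moreover have "e\<^sup>2 / s > 0" using e s by simp
  then obtain N where "(norm h)\<^sup>2 < real N * (e\<^sup>2 / s)"
    using reals_Archimedean3 by blast
  ultimately show False
    by (meson not_less)
qed

section \<open>The biderivation identity and the graph that \<open>W\<close> has to extend\<close>

context commuting_map
begin

text \<open>\<open>[T x, y]\<close> is a derivation in \<open>y\<close> by definition and in
  \<open>x\<close> because it equals \<open>[x, T y]\<close>. Expanding its value at
  \<open>(a x, b y)\<close> in the two possible orders and comparing gives the identity.\<close>

lemma biderivation_exchange:
  assumes "a \<in> U" "b \<in> U" "x \<in> U" "y \<in> U"
  shows "commutator (T a) b o\<^sub>L commutator x y = commutator a b o\<^sub>L commutator (T x) y"
proof -
  let ?D = "\<lambda>x y. commutator (T x) y"
  have left: "?D (u o\<^sub>L v) w = (?D u w o\<^sub>L v) + (u o\<^sub>L ?D v w)" if "u \<in> U" "v \<in> U" "w \<in> U" for u v w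
    using that by (simp add: commuting commutator_comp_left)
  have right: "?D u (v o\<^sub>L w) = (?D u v o\<^sub>L w) + (v o\<^sub>L ?D u w)" for u v w
    by (rule commutator_comp_right)
  have "?D (a o\<^sub>L x) (b o\<^sub>L y)
      = (((?D a b o\<^sub>L x) + (a o\<^sub>L ?D x b)) o\<^sub>L y) + (b o\<^sub>L ((?D a y o\<^sub>L x) + (a o\<^sub>L ?D x y)))"
    using assms by (simp add: right left)
  moreover have "?D (a o\<^sub>L x) (b o\<^sub>L y)
      = (((?D a b o\<^sub>L y) + (b o\<^sub>L ?D a y)) o\<^sub>L x) + (a o\<^sub>L ((?D x b o\<^sub>L y) + (b o\<^sub>L ?D x y)))"
    using left[of a x "b o\<^sub>L y"] assms by (simp only: right comp_in)
  ultimately have "(?D a b o\<^sub>L (x o\<^sub>L y)) + (b o\<^sub>L (a o\<^sub>L ?D x y))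
      = (?D a b o\<^sub>L (y o\<^sub>L x)) + (a o\<^sub>L (b o\<^sub>L ?D x y))"
    by (simp add: comp_simps algebra_simps)
  moreover have "P - R = S - Q" if "P + Q = R + S" for P Q R S :: "'h \<Rightarrow>\<^sub>L 'h"
    using that by (simp add: algebra_simps)
  ultimately show ?thesis
    unfolding commutator_def[of x y] commutator_def[of a b] comp_simps by blast
qed

text \<open>A relation instead of a function, because it is not clear in advance that
  \<open>[x, y] h\<close> determines \<open>[T x, y] h\<close>, even less so for sums; for maps
  commuting with the adjoint \<open>graph_bounded\<close> supplies this. The real span is closed
  under complex scalars by \<open>graph_apply\<close>.\<close>

definition commutator_graph :: "('h \<times> 'h) set" where
  "commutator_graph = span {(blinfun_apply (commutator x y) h, blinfun_apply (commutator (T x) y) h)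
     | x y h. x \<in> U \<and> y \<in> U}"

definition commutator_space :: "'h set" where
  "commutator_space = closure (fst ` commutator_graph)"

lemma subspace_graph: "subspace commutator_graph"
  unfolding commutator_graph_def by (rule subspace_span)

lemma graph_gen:
  "x \<in> U \<Longrightarrow> y \<in> U \<Longrightarrow>
    (blinfun_apply (commutator x y) h, blinfun_apply (commutator (T x) y) h) \<in> commutator_graph"
  unfolding commutator_graph_def by (rule span_base) blast

text \<open>Scalars are absorbed into \<open>h\<close>, so finite sums of generators suffice and no
  coefficients appear in later inductions.\<close>

lemma graph_induct [consumes 1, case_names zero add]:
  assumes "p \<in> commutator_graph" and "P 0"
    and add: "\<And>x y h q. x \<in> U \<Longrightarrow> y \<in> U \<Longrightarrow> q \<in> commutator_graph \<Longrightarrow> P q \<Longrightarrow>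
      P ((blinfun_apply (commutator x y) h, blinfun_apply (commutator (T x) y) h) + q)"
  shows "P p"
proof -
  have "p \<in> commutator_graph \<and> P p"
    using assms(1) unfolding commutator_graph_def
  proof (induction p rule: span_induct_alt)
    case (step c p q)
    then obtain x y h where xy: "x \<in> U" "y \<in> U"
      and p: "p = (blinfun_apply (commutator x y) h, blinfun_apply (commutator (T x) y) h)"
      by blast
    have "c *\<^sub>R p = (blinfun_apply (commutator x y) (c *\<^sub>R h), blinfun_apply (commutator (T x) y) (c *\<^sub>R h))"
      by (simp add: p blinfun.scaleR_right)
    then show ?case
      using add[OF xy, of q "c *\<^sub>R h"] step graph_gen[OF xy, of "c *\<^sub>R h"]
        subspace_add[OF subspace_graph, of "c *\<^sub>R p" q]
      unfolding commutator_graph_def by simp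
  qed (use assms(2) span_zero in auto)
  then show ?thesis ..
qed

text \<open>\<open>A [x, y] = [A x, y] - [A, y] x\<close>, and the same formula with
  \<open>T\<close> applied to the first entry of each bracket, so \<open>A\<close> maps a generator
  to a difference of generators. This is why \<open>W\<close> will commute with
  \<open>U\<close>.\<close>

lemma graph_apply:
  assumes "p \<in> commutator_graph" and A: "A \<in> U"
  shows "(blinfun_apply A (fst p), blinfun_apply A (snd p)) \<in> commutator_graph"
  using assms(1)
proof (induction p rule: graph_induct)
  case zero
  show ?case using subspace_0[OF subspace_graph] by (simp add: zero_prod_def)
next
  case (add x y h q)
  have "A o\<^sub>L commutator x y = commutator (A o\<^sub>L x) y - (commutator A y o\<^sub>L x)"
    by (simp add: commutator_comp_left)
  moreover have "A o\<^sub>L commutator (T x) y = commutator (T (A o\<^sub>L x)) y - (commutator (T A) y o\<^sub>L x)"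
    using A add by (simp add: commuting commutator_comp_left)
  ultimately have "(blinfun_apply (A o\<^sub>L commutator x y) h, blinfun_apply (A o\<^sub>L commutator (T x) y) h)
      = (blinfun_apply (commutator (A o\<^sub>L x) y) h, blinfun_apply (commutator (T (A o\<^sub>L x)) y) h)
      - (blinfun_apply (commutator A y) (blinfun_apply x h), blinfun_apply (commutator (T A) y) (blinfun_apply x h))"
    by (simp add: blinfun.diff_left)
  also have "\<dots> \<in> commutator_graph"
    using A add by (intro subspace_diff[OF subspace_graph] graph_gen) auto
  finally have "(blinfun_apply (A o\<^sub>L commutator x y) h, blinfun_apply (A o\<^sub>L commutator (T x) y) h)
      \<in> commutator_graph" .
  from subspace_add[OF subspace_graph this add.IH] show ?case
    by (simp add: blinfun.add_right)
qed

lemma commutator_space_apply: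
  assumes "k \<in> commutator_space" and A: "A \<in> U"
  shows "blinfun_apply A k \<in> commutator_space"
proof -
  have "blinfun_apply A ` closure (fst ` commutator_graph)
      \<subseteq> closure (blinfun_apply A ` fst ` commutator_graph)"
    by (rule closure_bounded_linear_image_subset[OF blinfun.bounded_linear_right])
  also have "\<dots> \<subseteq> closure (fst ` commutator_graph)"
  proof (intro closure_mono subsetI)
    fix v assume "v \<in> blinfun_apply A ` fst ` commutator_graph"
    then obtain p where "p \<in> commutator_graph" "v = blinfun_apply A (fst p)" by blast
    then show "v \<in> fst ` commutator_graph"
      using imageI[OF graph_apply[OF _ A], of p fst] by simp
  qed
  finally show ?thesis
    using assms(1) unfolding commutator_space_def by blast
qed

lemma closure_graph_apply:
  assumes "(k, k') \<in> closure commutator_graph" and A: "A \<in> U"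
  shows "(blinfun_apply A k, blinfun_apply A k') \<in> closure commutator_graph"
proof -
  let ?f = "\<lambda>p. (blinfun_apply A (fst p), blinfun_apply A (snd p))"
  have "?f ` closure commutator_graph \<subseteq> closure (?f ` commutator_graph)"
    by (intro closure_bounded_linear_image_subset bounded_linear_Pair
        bounded_linear_compose[OF blinfun.bounded_linear_right]
        bounded_linear_fst bounded_linear_snd)
  also have "\<dots> \<subseteq> closure commutator_graph"
    using graph_apply[OF _ A] by (intro closure_mono) auto
  finally show ?thesis
    using assms(1) by force
qed

lemma scalar_apply: "blinfun_apply (op_scaleC c id_blinfun) x = c *\<^sub>C x"
  by (simp add: op_scaleC.rep_eq)

lemma fst_closure_graph: "p \<in> closure commutator_graph \<Longrightarrow> fst p \<in> commutator_space"
  using closure_bounded_linear_image_subset[OF bounded_linear_fst, of commutator_graph]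
  unfolding commutator_space_def by blast

text \<open>\<open>[T x, y] h\<close> is again a commutator applied to a vector. This puts the range
  of \<open>W\<close> inside the space on which the damping argument works.\<close>

lemma snd_closure_graph:
  assumes "p \<in> closure commutator_graph"
  shows "snd p \<in> commutator_space"
proof -
  have snd_in: "snd q \<in> fst ` commutator_graph" if "q \<in> commutator_graph" for q
    using that
  proof (induction q rule: graph_induct)
    case zero
    show ?case using subspace_0[OF subspace_graph] by force
  next
    case (add x y h q)
    then obtain r where "r \<in> commutator_graph" "snd q = fst r" by blast
    then show ?case
      using subspace_add[OF subspace_graph graph_gen[OF T_in[OF add(1)] add(2), of h], of r]
      by force
  qed
  have "snd p \<in> closure (snd ` commutator_graph)"
    using closure_bounded_linear_image_subset[OF bounded_linear_snd, of commutator_graph] assms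
    by blast
  also have "\<dots> \<subseteq> commutator_space"
    unfolding commutator_space_def using snd_in by (intro closure_mono) blast
  finally show ?thesis .
qed

lemma subspace_commutator_space: "subspace commutator_space"
  unfolding commutator_space_def
  by (intro subspace_closure linear_subspace_image subspace_graph bounded_linear.linear bounded_linear_fst)

end

section \<open>Symmetry and boundedness of the graph for maps commuting with the adjoint\<close>

locale hermitian_commuting_map = commuting_map U T
  for U :: "('h::complex_hilbert_space \<Rightarrow>\<^sub>L 'h) set" and T +
  assumes hermitian: "A \<in> U \<Longrightarrow> T (adj A) = adj (T A)"
begin

text \<open>On generators the claim is \<open>adj [u, v] [T x, y] = adj [T u, v] [x, y]\<close>,
  which is \<open>biderivation_exchange\<close> at \<open>adj v\<close> and \<open>adj u\<close>
  once \<open>T\<close> passes through the adjoint.\<close>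

lemma graph_symmetric:
  assumes "p \<in> commutator_graph" "q \<in> commutator_graph"
  shows "cinner (snd p) (fst q) = cinner (fst p) (snd q)"
  using assms(1)
proof (induction p rule: graph_induct)
  case (add x y h p)
  have "cinner (blinfun_apply (commutator (T x) y) h) (fst q)
      = cinner (blinfun_apply (commutator x y) h) (snd q)"
    using assms(2)
  proof (induction q rule: graph_induct)
    case (add u v g q)
    have "adj (commutator u v) o\<^sub>L commutator (T x) y = adj (commutator (T u) v) o\<^sub>L commutator x y"
      using add \<open>x \<in> U\<close> \<open>y \<in> U\<close> biderivation_exchange[of "adj v" "adj u" x y]
      by (simp add: adj_commutator commuting hermitian)
    then have "cinner (blinfun_apply (commutator (T x) y) h) (blinfun_apply (commutator u v) g)
      = cinner (blinfun_apply (commutator x y) h) (blinfun_apply (commutator (T u) v) g)"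
      using add by (simp add: cinner_adj' flip: blinfun_apply_blinfun_compose)
    with add show ?case
      by (simp add: cinner.add_right)
  qed (simp add: cinner.zero_right)
  with add show ?case
    by (simp add: cinner.add_left)
qed (simp add: cinner.zero_left)

text \<open>Applying \<open>T\<close> repeatedly inside the generators extends \<open>p\<close> to a
  chain \<open>k\<close> in the graph. Symmetry gives
  \<open>(norm (k (Suc n)))\<^sup>2 = cinner (k n) (k (Suc (Suc n)))\<close>, hence log-convexity.
  The factor \<open>K\<close> depends on how \<open>p\<close> is written as a sum, but the rate
  \<open>C\<close> does not.\<close>

lemma graph_bounded:
  obtains C where "C > 0" and "\<And>p. p \<in> commutator_graph \<Longrightarrow> norm (snd p) \<le> C * norm (fst p)"
proof -
  obtain C where C: "C > 0" and iter:
    "\<And>x y n. x \<in> U \<Longrightarrow> y \<in> U \<Longrightarrow> norm (commutator ((T ^^ n) x) y) \<le> 2 * C ^ n * norm x * norm y"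
    by (rule iterated_commutator_bound) blast
  have chain: "\<exists>k K. k 0 = fst p \<and> k 1 = snd p \<and> (\<forall>n. (k n, k (Suc n)) \<in> commutator_graph)
      \<and> (\<forall>n. norm (k n) \<le> K * C ^ n)" if "p \<in> commutator_graph" for p
    using that
  proof (induction p rule: graph_induct)
    case zero
    show ?case
      using subspace_0[OF subspace_graph] by (intro exI[of _ "\<lambda>_. 0"] exI[of _ 0]) (auto simp: zero_prod_def)
  next
    case (add x y h q)
    then obtain k K where k: "k 0 = fst q" "k 1 = snd q" "\<And>n. (k n, k (Suc n)) \<in> commutator_graph"
      "\<And>n. norm (k n) \<le> K * C ^ n"
      by blast
    define l where "l n = blinfun_apply (commutator ((T ^^ n) x) y) h" for n
    have l: "(l n, l (Suc n)) \<in> commutator_graph" for n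
      using graph_gen[OF iterate_in[OF add(1)] add(2)] by (simp add: l_def)
    have graph: "(l n + k n, l (Suc n) + k (Suc n)) \<in> commutator_graph" for n
      using subspace_add[OF subspace_graph l[of n] k(3)[of n]] by simp
    have "norm (l n + k n) \<le> (2 * norm x * norm y * norm h + K) * C ^ n" for n
    proof -
      have "norm (l n) \<le> norm (commutator ((T ^^ n) x) y) * norm h"
        unfolding l_def by (rule norm_blinfun)
      also have "\<dots> \<le> (2 * C ^ n * norm x * norm y) * norm h"
        using add by (intro mult_right_mono iter) auto
      finally have "norm (l n) \<le> (2 * C ^ n * norm x * norm y) * norm h" .
      then have "norm (l n + k n) \<le> (2 * C ^ n * norm x * norm y) * norm h + K * C ^ n"
        using k(4) by (intro norm_triangle_le add_mono)
      then show ?thesis by (simp add: algebra_simps)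
    qed
    with graph show ?case
      by (intro exI[of _ "\<lambda>n. l n + k n"] exI[of _ "2 * norm x * norm y * norm h + K"])
        (simp add: l_def k k(2)[unfolded One_nat_def])
  qed
  show thesis
  proof (rule that[OF C])
    fix p assume "p \<in> commutator_graph"
    then obtain k K where k: "k 0 = fst p" "k 1 = snd p" "\<And>n. (k n, k (Suc n)) \<in> commutator_graph"
      "\<And>n. norm (k n) \<le> K * C ^ n"
      using chain by blast
    have "norm (k 1) \<le> C * norm (k 0)"
    proof (rule log_convex_first_step[OF C, of "\<lambda>n. norm (k n)"])
      fix n
      have "(norm (k (Suc n)))\<^sup>2 = Re (cinner (k (Suc n)) (k (Suc n)))"
        by (simp add: Re_cinner_self)
      also have "\<dots> = Re (cinner (k n) (k (Suc (Suc n))))"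
        using graph_symmetric[OF k(3)[of n] k(3)[of "Suc n"]] by simp
      also have "\<dots> \<le> norm (k n) * norm (k (Suc (Suc n)))"
        using complex_Re_le_cmod cauchy_schwarz order_trans by blast
      finally show "(norm (k (Suc n)))\<^sup>2 \<le> norm (k n) * norm (k (Suc (Suc n)))" .
    qed (use k in auto)
    then show "norm (snd p) \<le> C * norm (fst p)"
      by (simp only: k)
  qed
qed

lemma closure_graph_bounded:
  obtains C where "C > 0" and "\<And>p. p \<in> closure commutator_graph \<Longrightarrow> norm (snd p) \<le> C * norm (fst p)"
proof -
  obtain C where C: "C > 0" and bound: "\<And>p. p \<in> commutator_graph \<Longrightarrow> norm (snd p) \<le> C * norm (fst p)"
    by (rule graph_bounded) blast
  have "closed {p :: 'h \<times> 'h. norm (snd p) \<le> C * norm (fst p)}"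
    by (intro closed_Collect_le continuous_intros)
  then have "closure commutator_graph \<subseteq> {p. norm (snd p) \<le> C * norm (fst p)}"
    using bound by (intro closure_minimal) auto
  then show thesis
    using that C by blast
qed

text \<open>The linear bound carries Cauchy sequences from first to second components, so the closed
  relation is defined on the closure of its domain.\<close>

lemma closure_graph_total:
  assumes "k \<in> commutator_space"
  shows "\<exists>k'. (k, k') \<in> closure commutator_graph"
proof -
  obtain C where C: "C > 0" and bound: "\<And>p. p \<in> commutator_graph \<Longrightarrow> norm (snd p) \<le> C * norm (fst p)"
    by (rule graph_bounded) blast
  obtain f where f: "\<forall>n. f n \<in> fst ` commutator_graph" and fk: "f \<longlonglongrightarrow> k"
    using assms unfolding commutator_space_def closure_sequential by blast
  from f have "\<forall>n. \<exists>v. (f n, v) \<in> commutator_graph"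
    by force
  then obtain g where g: "\<And>n. (f n, g n) \<in> commutator_graph"
    by metis
  have "Cauchy g"
  proof (rule metric_CauchyI)
    fix e :: real assume "e > 0"
    then have "e / C > 0" using C by simp
    then obtain M where M: "\<And>m n. m \<ge> M \<Longrightarrow> n \<ge> M \<Longrightarrow> dist (f m) (f n) < e / C"
      using metric_CauchyD[OF LIMSEQ_imp_Cauchy[OF fk]] by metis
    show "\<exists>M. \<forall>m\<ge>M. \<forall>n\<ge>M. dist (g m) (g n) < e"
    proof (intro exI allI impI)
      fix m n assume "m \<ge> M" "n \<ge> M"
      have "norm (g m - g n) \<le> C * norm (f m - f n)"
        using bound[OF subspace_diff[OF subspace_graph g[of m] g[of n]]] by simp
      also have "\<dots> < C * (e / C)"
        using M[OF \<open>m \<ge> M\<close> \<open>n \<ge> M\<close>] C by (intro mult_strict_left_mono) (auto simp: dist_norm)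
      finally show "dist (g m) (g n) < e"
        using C by (simp add: dist_norm)
    qed
  qed
  then obtain k' where "g \<longlonglongrightarrow> k'"
    using Cauchy_convergent convergent_def by blast
  with fk have "(\<lambda>n. (f n, g n)) \<longlonglongrightarrow> (k, k')"
    by (rule tendsto_Pair)
  then show ?thesis
    unfolding closure_sequential using g by (intro exI[of _ k'] exI[of _ "\<lambda>n. (f n, g n)"]) simp
qed

text \<open>The graph of \<open>W\<close> extended by zero: \<open>k\<close> is the orthogonal
  projection of \<open>h\<close> onto \<open>commutator_space\<close>. In relational form, linearity
  and commutation with \<open>U\<close> can be checked before a value is chosen.\<close>

definition implements :: "'h \<Rightarrow> 'h \<Rightarrow> bool" where
  "implements h w \<longleftrightarrow>
    (\<exists>k. (k, w) \<in> closure commutator_graph \<and> (\<forall>l\<in>commutator_space. cinner (h - k) l = 0))"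

lemma implements_ex: "\<exists>w. implements h w"
proof -
  have "closed commutator_space"
    by (simp add: commutator_space_def)
  then obtain k where "k \<in> commutator_space" "\<And>l. l \<in> commutator_space \<Longrightarrow> cinner (h - k) l = 0"
  proof (rule orthogonal_projection_exists)
    show "0 \<in> commutator_space"
      by (rule subspace_0[OF subspace_commutator_space])
    show "x + y \<in> commutator_space" if "x \<in> commutator_space" "y \<in> commutator_space" for x y
      using that by (rule subspace_add[OF subspace_commutator_space])
    show "c *\<^sub>C x \<in> commutator_space" if "x \<in> commutator_space" for c x
      using commutator_space_apply[OF that, of "op_scaleC c id_blinfun"] by (simp add: scalar_apply)
  qed blast
  then show ?thesis
    using closure_graph_total unfolding implements_def by blast
qed

lemma implements_unique:
  assumes "implements h v" "implements h w"
  shows "v = w"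
proof -
  obtain C where bound: "\<And>p. p \<in> closure commutator_graph \<Longrightarrow> norm (snd p) \<le> C * norm (fst p)"
    by (rule closure_graph_bounded) blast
  obtain k l where k: "(k, v) \<in> closure commutator_graph" "\<And>m. m \<in> commutator_space \<Longrightarrow> cinner (h - k) m = 0"
    and l: "(l, w) \<in> closure commutator_graph" "\<And>m. m \<in> commutator_space \<Longrightarrow> cinner (h - l) m = 0"
    using assms unfolding implements_def by blast
  have kl: "(k - l, v - w) \<in> closure commutator_graph"
    using subspace_diff[OF subspace_closure[OF subspace_graph] k(1) l(1)] by simp
  then have mem: "k - l \<in> commutator_space"
    using fst_closure_graph by force
  have "cinner (k - l) (k - l) = cinner (h - l) (k - l) - cinner (h - k) (k - l)"
    by (simp add: cinner.diff_left)
  also have "\<dots> = 0"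
    using k(2)[OF mem] l(2)[OF mem] by simp
  finally have "k - l = 0"
    by (simp add: cinner_self)
  then show ?thesis
    using bound[OF kl] by simp
qed

lemma implements_add:
  assumes "implements g v" "implements h w"
  shows "implements (g + h) (v + w)"
proof -
  obtain k l where "(k, v) \<in> closure commutator_graph" "(l, w) \<in> closure commutator_graph"
    and orth: "\<forall>m\<in>commutator_space. cinner (g - k) m = 0" "\<forall>m\<in>commutator_space. cinner (h - l) m = 0"
    using assms unfolding implements_def by blast
  then have "(k + l, v + w) \<in> closure commutator_graph"
    using subspace_add[OF subspace_closure[OF subspace_graph], of "(k, v)" "(l, w)"] by simp
  moreover have "(g + h) - (k + l) = (g - k) + (h - l)"
    by simp
  then have "\<forall>m\<in>commutator_space. cinner ((g + h) - (k + l)) m = 0"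
    using orth by (simp only: cinner.add_left) simp
  ultimately show ?thesis
    unfolding implements_def by blast
qed

text \<open>\<open>commutator_space\<close> is invariant under \<open>A\<close> and under
  \<open>adj A\<close>, so \<open>A\<close> also respects its orthogonal complement.\<close>

lemma implements_apply:
  assumes "implements h w" and A: "A \<in> U"
  shows "implements (blinfun_apply A h) (blinfun_apply A w)"
proof -
  obtain k where k: "(k, w) \<in> closure commutator_graph"
    and orth: "\<forall>m\<in>commutator_space. cinner (h - k) m = 0"
    using assms unfolding implements_def by blast
  have "cinner (blinfun_apply A h - blinfun_apply A k) m = 0" if "m \<in> commutator_space" for m
    using orth commutator_space_apply[OF that adj_in[OF A]] A
    by (simp add: cinner_adj flip: blinfun.diff_right)
  then show ?thesis
    using closure_graph_apply[OF k A] unfolding implements_def by blast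
qed

lemma implements_scaleC: "implements h w \<Longrightarrow> implements (c *\<^sub>C h) (c *\<^sub>C w)"
  using implements_apply[of h w "op_scaleC c id_blinfun"] by (simp add: scalar_apply)

lemma implements_bounded:
  obtains C where "\<And>h w. implements h w \<Longrightarrow> norm w \<le> norm h * C"
proof -
  obtain C where C: "C > 0" and bound: "\<And>p. p \<in> closure commutator_graph \<Longrightarrow> norm (snd p) \<le> C * norm (fst p)"
    by (rule closure_graph_bounded) blast
  show thesis
  proof (rule that)
    fix h w assume "implements h w"
    then obtain k where k: "(k, w) \<in> closure commutator_graph"
      and orth: "\<forall>m\<in>commutator_space. cinner (h - k) m = 0"
      unfolding implements_def by blast
    have "cinner (h - k) k = 0"
      using orth fst_closure_graph[OF k] by simp
    then have "(norm k)\<^sup>2 \<le> (norm h)\<^sup>2"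
      using norm_add_sq[of "h - k" k] by simp
    then have "norm k \<le> norm h"
      by (rule power2_le_imp_le) simp
    then have "C * norm k \<le> C * norm h"
      using C by simp
    then show "norm w \<le> norm h * C"
      using bound[OF k] by (simp add: mult.commute)
  qed
qed

lemma implementing_operator:
  obtains W where "W \<in> bounded_operators"
    "\<And>A. A \<in> U \<Longrightarrow> W o\<^sub>L A = A o\<^sub>L W"
    "\<And>x y. x \<in> U \<Longrightarrow> y \<in> U \<Longrightarrow> W o\<^sub>L commutator x y = commutator (T x) y"
    "\<And>h. blinfun_apply W h \<in> commutator_space"
proof -
  obtain f where f: "\<And>h. implements h (f h)"
    using implements_ex by metis
  have f_eq: "f h = w" if "implements h w" for h w
    using implements_unique[OF f that] .
  obtain C where "\<And>h w. implements h w \<Longrightarrow> norm w \<le> norm h * C"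
    by (rule implements_bounded) blast
  then have "bounded_linear f"
  proof (intro bounded_linear_intro[where K = C])
    show "f (x + y) = f x + f y" for x y
      by (intro f_eq implements_add f)
    show "f (r *\<^sub>R x) = r *\<^sub>R f x" for r x
      using implements_scaleC[OF f[of x], of "complex_of_real r"] f_eq by (simp add: scaleC_of_real)
  qed (use f in blast)
  then have W: "blinfun_apply (Blinfun f) = f"
    by (rule bounded_linear_Blinfun_apply)
  show thesis
  proof (rule that[of "Blinfun f"])
    show "Blinfun f \<in> bounded_operators"
      using f_eq[OF implements_scaleC[OF f]] by (simp add: bounded_operators_def W)
    show "Blinfun f o\<^sub>L A = A o\<^sub>L Blinfun f" if "A \<in> U" for A
      by (rule blinfun_eqI) (simp add: W f_eq[OF implements_apply[OF f that]])
    show "Blinfun f o\<^sub>L commutator x y = commutator (T x) y" if "x \<in> U" "y \<in> U" for x y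
    proof (rule blinfun_eqI)
      fix h
      have "implements (blinfun_apply (commutator x y) h) (blinfun_apply (commutator (T x) y) h)"
        unfolding implements_def
        using graph_gen[OF that, of h] closure_subset[of commutator_graph]
        by (intro exI[of _ "blinfun_apply (commutator x y) h"]) (auto simp: cinner.zero_left)
      then show "blinfun_apply (Blinfun f o\<^sub>L commutator x y) h = blinfun_apply (commutator (T x) y) h"
        by (simp add: W f_eq)
    qed
    show "blinfun_apply (Blinfun f) h \<in> commutator_space" for h
      using f[of h] snd_closure_graph unfolding implements_def W by force
  qed
qed

text \<open>\<open>damper W\<close> contains \<open>id - e\<close> for the elements \<open>e\<close> of a bounded approximate identity of the
  ideal generated by the commutators.\<close>

definition damper :: "('h \<Rightarrow>\<^sub>L 'h) \<Rightarrow> ('h \<Rightarrow>\<^sub>L 'h) set" where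
  "damper W = {b \<in> U. norm b \<le> 1 \<and> W o\<^sub>L (id_blinfun - b) \<in> U}"

text \<open>Smallness is demanded after an arbitrary earlier damper \<open>a\<close>. This lets
  several vectors be damped one after another, since the later ones have already been moved by the
  earlier dampers.\<close>

definition damped :: "('h \<Rightarrow>\<^sub>L 'h) \<Rightarrow> 'h \<Rightarrow> bool" where
  "damped W k \<longleftrightarrow>
    (\<forall>a\<in>damper W. \<forall>e>0. \<exists>b\<in>damper W. norm (blinfun_apply b (blinfun_apply a k)) < e)"

lemma id_damper: "id_blinfun \<in> damper W"
  by (simp add: damper_def norm_blinfun_id_le)

lemma damper_norm: "b \<in> damper W \<Longrightarrow> norm (blinfun_apply b v) \<le> norm v"
proof -
  assume "b \<in> damper W"
  then have "norm b * norm v \<le> 1 * norm v"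
    by (intro mult_right_mono) (auto simp: damper_def)
  then show ?thesis
    using norm_blinfun[of b v] by simp
qed

section \<open>Damping on the commutator space by elements of the algebra\<close>

context
  fixes W
  assumes W_comm: "\<And>A. A \<in> U \<Longrightarrow> W o\<^sub>L A = A o\<^sub>L W"
begin

text \<open>\<open>1 - a b = (1 - a) + a (1 - b)\<close>, and \<open>W\<close> can be moved past
  \<open>a\<close>.\<close>

lemma damper_comp:
  assumes "a \<in> damper W" "b \<in> damper W"
  shows "a o\<^sub>L b \<in> damper W"
proof -
  have "norm (a o\<^sub>L b) \<le> norm a * norm b"
    by (rule norm_blinfun_compose)
  also have "\<dots> \<le> 1 * 1"
    using assms by (intro mult_mono) (auto simp: damper_def)
  finally have "norm (a o\<^sub>L b) \<le> 1" by simp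
  moreover have "W o\<^sub>L (id_blinfun - (a o\<^sub>L b)) = (W o\<^sub>L (id_blinfun - a)) + (a o\<^sub>L (W o\<^sub>L (id_blinfun - b)))"
  proof -
    have "id_blinfun - (a o\<^sub>L b) = (id_blinfun - a) + (a o\<^sub>L (id_blinfun - b))"
      by (rule blinfun_eqI) (simp add: blinfun.diff_left blinfun.add_left blinfun.diff_right)
    moreover have "W o\<^sub>L (a o\<^sub>L (id_blinfun - b)) = a o\<^sub>L (W o\<^sub>L (id_blinfun - b))"
      using W_comm[of a] assms(1) unfolding damper_def
      by (simp only: blinfun_compose_assoc[symmetric] mem_Collect_eq)
    ultimately show ?thesis
      by (simp only: comp_simps(3))
  qed
  ultimately show ?thesis
    using assms by (simp add: damper_def)
qed

text \<open>With \<open>f = a c\<close>, also \<open>W f = a (W c)\<close> lies in \<open>U\<close>.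
  Hence \<open>b = 1 - f (adj f) / s\<close> and its powers are dampers, and the powers tend to zero
  on the range of \<open>f\<close>.\<close>

lemma damped_range:
  assumes c: "c \<in> U" "W o\<^sub>L c \<in> U"
  shows "damped W (blinfun_apply c h)"
  unfolding damped_def
proof (intro ballI allI impI)
  fix a and e :: real
  assume a: "a \<in> damper W" and e: "e > 0"
  define f where "f = a o\<^sub>L c"
  have aU: "a \<in> U" using a by (simp add: damper_def)
  have "W o\<^sub>L f = a o\<^sub>L (W o\<^sub>L c)"
    by (simp only: f_def W_comm[OF aU] blinfun_compose_assoc[symmetric])
  then have f: "f \<in> U" "W o\<^sub>L f \<in> U"
    using c aU by (simp_all add: f_def)
  \<comment> \<open>One square makes \<open>b\<close> a contraction, the other serves
    \<open>damping_iterates\<close>, and the 1 keeps \<open>s\<close> positive.\<close>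
  define s where "s = (norm f)\<^sup>2 + (norm (adj f))\<^sup>2 + 1"
  have s: "s > 0" "(norm f)\<^sup>2 \<le> s" "(norm (adj f))\<^sup>2 \<le> s"
    by (simp_all add: s_def add_nonneg_pos)
  define b where "b = id_blinfun - (1 / s) *\<^sub>R (f o\<^sub>L adj f)"
  let ?B = "\<lambda>v. v - (1 / s) *\<^sub>R blinfun_apply f (blinfun_apply (adj f) v)"
  have b_apply: "blinfun_apply b = ?B"
    by (rule ext) (simp add: b_def blinfun.diff_left blinfun.scaleR_left)
  have b: "b \<in> damper W"
  proof -
    have "norm (blinfun_apply b v) \<le> 1 * norm v" for v
    proof -
      have "(norm (blinfun_apply b v))\<^sup>2 \<le> (norm v)\<^sup>2 - (norm (blinfun_apply (adj f) v))\<^sup>2 / s"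
        unfolding b_apply by (rule norm_sq_sub_compose[OF is_adjoint_adj[OF f(1)] s(1,2)])
      also have "\<dots> \<le> (norm v)\<^sup>2"
        using s by simp
      finally show ?thesis
        unfolding mult_1 by (rule power2_le_imp_le) simp
    qed
    then have "norm b \<le> 1"
      by (intro norm_blinfun_bound) auto
    moreover have "W o\<^sub>L (id_blinfun - b) = (1 / s) *\<^sub>R ((W o\<^sub>L f) o\<^sub>L adj f)"
      by (simp add: b_def comp_simps)
    ultimately show ?thesis
      using f unfolding damper_def by (auto simp: b_def)
  qed
  have powers: "\<exists>d\<in>damper W. blinfun_apply d = ?B ^^ N" for N
  proof (induction N)
    case 0
    have "blinfun_apply id_blinfun = ?B ^^ 0" by (rule ext) simp
    then show ?case using id_damper by blast
  next
    case (Suc N)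
    then obtain d where d: "d \<in> damper W" "blinfun_apply d = ?B ^^ N" by blast
    have "blinfun_apply (b o\<^sub>L d) = ?B ^^ Suc N"
      by (rule ext) (simp only: blinfun_apply_blinfun_compose b_apply d(2) funpow.simps comp_apply)
    then show ?case
      using damper_comp[OF b d(1)] by blast
  qed
  obtain N where "norm ((?B ^^ N) (blinfun_apply f h)) < e"
    using damping_iterates[OF is_adjoint_adj[OF f(1)] s(1,3) e] by blast
  moreover obtain d where "d \<in> damper W" and d: "blinfun_apply d = ?B ^^ N"
    using powers by blast
  ultimately have "norm (blinfun_apply d (blinfun_apply a (blinfun_apply c h))) < e"
    by (simp only: d f_def blinfun_apply_blinfun_compose)
  with \<open>d \<in> damper W\<close>
  show "\<exists>b\<in>damper W. norm (blinfun_apply b (blinfun_apply a (blinfun_apply c h))) < e" ..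
qed

text \<open>First damp \<open>k\<close> by \<open>b\<close>, then \<open>l\<close> by
  \<open>c\<close> relative to \<open>b a\<close>; being a contraction, \<open>c\<close> does not
  spoil the first estimate.\<close>

lemma damped_add:
  assumes "damped W k" "damped W l"
  shows "damped W (k + l)"
  unfolding damped_def
proof (intro ballI allI impI)
  fix a and e :: real
  assume a: "a \<in> damper W" and e: "e > 0"
  obtain b where b: "b \<in> damper W" "norm (blinfun_apply b (blinfun_apply a k)) < e / 2"
    using assms(1) a e unfolding damped_def by (meson half_gt_zero)
  obtain c where c: "c \<in> damper W" "norm (blinfun_apply c (blinfun_apply (b o\<^sub>L a) l)) < e / 2"
    using assms(2) damper_comp[OF b(1) a] e unfolding damped_def by (meson half_gt_zero)
  have "norm (blinfun_apply (c o\<^sub>L b) (blinfun_apply a (k + l)))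
      \<le> norm (blinfun_apply c (blinfun_apply b (blinfun_apply a k)))
        + norm (blinfun_apply c (blinfun_apply (b o\<^sub>L a) l))"
    by (simp add: blinfun.add_right norm_triangle_ineq)
  also have "\<dots> < e"
    using damper_norm[OF c(1), of "blinfun_apply b (blinfun_apply a k)"] b c by simp
  finally show "\<exists>b\<in>damper W. norm (blinfun_apply b (blinfun_apply a (k + l))) < e"
    using damper_comp[OF c(1) b(1)] by blast
qed

lemma damped_closure:
  assumes "\<And>k. k \<in> S \<Longrightarrow> damped W k" and l: "l \<in> closure S"
  shows "damped W l"
  unfolding damped_def
proof (intro ballI allI impI)
  fix a and e :: real
  assume a: "a \<in> damper W" and e: "e > 0"
  obtain k where k: "k \<in> S" "norm (l - k) < e / 2"
    using l e unfolding closure_approachable by (metis dist_norm half_gt_zero norm_minus_commute)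
  obtain b where b: "b \<in> damper W" "norm (blinfun_apply b (blinfun_apply a k)) < e / 2"
    using assms(1)[OF k(1)] a e unfolding damped_def by (meson half_gt_zero)
  have "blinfun_apply b (blinfun_apply a l)
      = blinfun_apply (b o\<^sub>L a) (l - k) + blinfun_apply b (blinfun_apply a k)"
    by (simp add: blinfun.diff_right)
  then have "norm (blinfun_apply b (blinfun_apply a l))
      \<le> norm (blinfun_apply (b o\<^sub>L a) (l - k)) + norm (blinfun_apply b (blinfun_apply a k))"
    by (simp only: norm_triangle_ineq)
  also have "\<dots> < e"
    using damper_norm[OF damper_comp[OF b(1) a], of "l - k"] b k by simp
  finally show "\<exists>b\<in>damper W. norm (blinfun_apply b (blinfun_apply a l)) < e"
    using b by blast
qed

lemma damped_finite:
  assumes "finite X" "\<And>x. x \<in> X \<Longrightarrow> damped W x" and e: "e > 0"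
  shows "\<exists>b\<in>damper W. \<forall>x\<in>X. norm (blinfun_apply b x) < e"
  using assms(1,2)
proof (induction X rule: finite_induct)
  case empty
  show ?case using id_damper by blast
next
  case (insert x X)
  then obtain b where b: "b \<in> damper W" "\<forall>x\<in>X. norm (blinfun_apply b x) < e" by auto
  obtain c where c: "c \<in> damper W" "norm (blinfun_apply c (blinfun_apply b x)) < e"
    using insert.prems[of x] b(1) e unfolding damped_def by blast
  have "norm (blinfun_apply (c o\<^sub>L b) y) < e" if "y \<in> insert x X" for y
    using that b(2) c damper_norm[OF c(1), of "blinfun_apply b y"] by auto
  then show ?case
    using damper_comp[OF c(1) b(1)] by blast
qed

end

theorem hermitian_implementation:
  "\<exists>W\<in>center U. \<forall>x\<in>U. \<forall>y\<in>U. commutator (T x) y = W o\<^sub>L commutator x y"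
proof -
  obtain W where W_bounded: "W \<in> bounded_operators"
    and W_comm: "\<And>A. A \<in> U \<Longrightarrow> W o\<^sub>L A = A o\<^sub>L W"
    and W_commutator: "\<And>x y. x \<in> U \<Longrightarrow> y \<in> U \<Longrightarrow> W o\<^sub>L commutator x y = commutator (T x) y"
    and W_range: "\<And>h. blinfun_apply W h \<in> commutator_space"
    by (rule implementing_operator) blast
  have "damped W (fst p)" if "p \<in> commutator_graph" for p
    using that
  proof (induction p rule: graph_induct)
    case zero
    show ?case
      unfolding damped_def using id_damper by (auto simp: blinfun.zero_right)
  next
    case (add x y h q)
    have "damped W (blinfun_apply (commutator x y) h)"
      using add by (intro damped_range W_comm) (simp_all add: W_commutator)
    then show ?case
      using damped_add[OF W_comm] add by simp
  qed
  then have damped: "damped W k" if "k \<in> commutator_space" for k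
    using damped_closure[OF W_comm, of "fst ` commutator_graph" k] that
    unfolding commutator_space_def by blast
  have "W \<in> U"
  proof (rule mem_if_strongly_approx[OF W_bounded])
    fix X :: "'h set" and e :: real assume "finite X" "e > 0"
    then have "\<exists>b\<in>damper W. \<forall>x\<in>blinfun_apply W ` X. norm (blinfun_apply b x) < e"
      using damped W_range by (intro damped_finite W_comm) auto
    then obtain b where b: "b \<in> damper W" "\<forall>x\<in>blinfun_apply W ` X. norm (blinfun_apply b x) < e"
      by blast
    \<comment> \<open>The error \<open>A - W = - b W\<close> is small on \<open>X\<close>, because
      \<open>b\<close> was chosen to damp the vectors \<open>W x\<close>.\<close>
    define A where "A = W o\<^sub>L (id_blinfun - b)"
    have "norm (blinfun_apply A x - blinfun_apply W x) < e" if "x \<in> X" for x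
    proof -
      have "blinfun_apply W (blinfun_apply b x) = blinfun_apply b (blinfun_apply W x)"
        using W_comm[of b] b(1) by (simp add: damper_def flip: blinfun_apply_blinfun_compose)
      then have "blinfun_apply A x - blinfun_apply W x = - blinfun_apply b (blinfun_apply W x)"
        by (simp add: A_def blinfun.diff_left blinfun.diff_right)
      then show ?thesis
        using b(2) that by simp
    qed
    moreover have "A \<in> U"
      using b(1) by (simp add: A_def damper_def)
    ultimately show "\<exists>A\<in>U. \<forall>x\<in>X. norm (blinfun_apply A x - blinfun_apply W x) < e"
      by blast
  qed
  then have "W \<in> center U"
    using W_comm by (simp add: center_def)
  then show ?thesis
    using W_commutator by (intro bexI[of _ W] ballI) simp
qed

end

section \<open>Commuting maps and Lie centralizers\<close>

lemma op_scaleC_minus_left: "op_scaleC (- c) A = - op_scaleC c A"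
  using op_scaleC_scaleC[of "complex_of_real (- 1)" c A]
  by (simp only: op_scaleC_of_real) simp

lemma (in von_neumann) adj_scaleR: "A \<in> U \<Longrightarrow> adj (r *\<^sub>R A) = r *\<^sub>R adj A"
  using adj_op_scaleC[of A "complex_of_real r"] by (simp add: op_scaleC_of_real)

lemma (in commuting_map) adjoint_map:
  "commuting_map U (\<lambda>A. adj (T (adj A)))"
proof (unfold_locales)
  fix A B assume A: "A \<in> U" and B: "B \<in> U"
  show "adj (T (adj (A + B))) = adj (T (adj A)) + adj (T (adj B))"
    using A B by (simp add: adj_add T_add)
  have "commutator (adj (T (adj A))) B = adj (commutator (adj B) (T (adj A)))"
    using A B by (simp add: adj_commutator)
  also have "\<dots> = adj (commutator (T (adj B)) (adj A))"
    using A B by (simp add: commuting)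
  also have "\<dots> = commutator A (adj (T (adj B)))"
    using A B by (simp add: adj_commutator)
  finally show "commutator (adj (T (adj A))) B = commutator A (adj (T (adj B)))" .
qed (simp_all add: adj_scaleR T_scaleR)

text \<open>\<open>A \<mapsto> adj (T (adj A))\<close> is an involution on commuting maps, so
  \<open>T\<close> splits as \<open>T1 + \<i> T2\<close> with both parts commuting with the adjoint,
  and their implementing elements combine in the same way.\<close>

theorem (in commuting_map) commutator_implementation:
  "\<exists>W\<in>center U. \<forall>x\<in>U. \<forall>y\<in>U. commutator (T x) y = W o\<^sub>L commutator x y"
proof -
  interpret adjoint: commuting_map U "\<lambda>A. adj (T (adj A))"
    by (rule adjoint_map)
  define T1 where "T1 A = (1/2) *\<^sub>R (T A + adj (T (adj A)))" for A
  define T2 where "T2 A = op_scaleC (- \<i> / 2) (T A - adj (T (adj A)))" for A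
  have comm: "commutator (T A + adj (T (adj A))) B = commutator A (T B + adj (T (adj B)))"
    "commutator (T A - adj (T (adj A))) B = commutator A (T B - adj (T (adj B)))"
    if "A \<in> U" "B \<in> U" for A B
    using that commuting adjoint.commuting
    by (simp_all add: commutator.add_left commutator.add_right commutator.diff_left commutator.diff_right)
  have scale: "op_scaleC c (r *\<^sub>R A) = r *\<^sub>R op_scaleC c A" for c r and A :: "'h \<Rightarrow>\<^sub>L 'h"
    by (simp add: op_scaleC_scaleC mult.commute flip: op_scaleC_of_real)
  interpret T1: hermitian_commuting_map U T1
  proof (unfold_locales)
    fix A B assume A: "A \<in> U" and B: "B \<in> U"
    show "T1 (A + B) = T1 A + T1 B"
      using A B by (simp add: T1_def T_add adjoint.T_add algebra_simps)
    show "commutator (T1 A) B = commutator A (T1 B)"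
      using A B comm by (simp add: T1_def commutator.scaleR_left commutator.scaleR_right)
  qed (simp_all add: T1_def T_scaleR adjoint.T_scaleR adj_scaleR adj_add algebra_simps)
  interpret T2: hermitian_commuting_map U T2
  proof (unfold_locales)
    fix A B assume A: "A \<in> U" and B: "B \<in> U"
    have "T (A + B) - adj (T (adj (A + B))) = (T A - adj (T (adj A))) + (T B - adj (T (adj B)))"
      using A B by (simp add: T_add adjoint.T_add)
    then show "T2 (A + B) = T2 A + T2 B"
      by (simp only: T2_def op_scaleC_add_right)
    show "commutator (T2 A) B = commutator A (T2 B)"
      using A B comm by (simp add: T2_def commutator_op_scaleC_left commutator_op_scaleC_right bounded_op)
  next
    fix A and r :: real assume A: "A \<in> U"
    have "T (r *\<^sub>R A) - adj (T (adj (r *\<^sub>R A))) = r *\<^sub>R (T A - adj (T (adj A)))"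
      using A by (simp add: T_scaleR adjoint.T_scaleR scaleR_diff_right)
    then show "T2 (r *\<^sub>R A) = r *\<^sub>R T2 A"
      by (simp only: T2_def scale)
  next
    fix A assume A: "A \<in> U"
    have "adj (T2 A) = op_scaleC (- (- \<i> / 2)) (adj (T A) - T (adj A))"
      using A by (simp add: T2_def adj_op_scaleC adj_diff)
    also have "\<dots> = op_scaleC (- \<i> / 2) (T (adj A) - adj (T A))"
      by (simp only: op_scaleC_minus_left op_scaleC_diff_right) simp
    finally show "T2 (adj A) = adj (T2 A)"
      using A by (simp add: T2_def)
  qed (simp add: T2_def)
  obtain V where V: "V \<in> center U" "\<forall>x\<in>U. \<forall>y\<in>U. commutator (T1 x) y = V o\<^sub>L commutator x y"
    using T1.hermitian_implementation by blast
  obtain W where W: "W \<in> center U" "\<forall>x\<in>U. \<forall>y\<in>U. commutator (T2 x) y = W o\<^sub>L commutator x y"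
    using T2.hermitian_implementation by blast
  have T_eq: "T A = T1 A + op_scaleC \<i> (T2 A)" for A
  proof -
    have "op_scaleC \<i> (T2 A) = (1/2) *\<^sub>R (T A - adj (T (adj A)))"
      using op_scaleC_of_real[of "1/2" "T A - adj (T (adj A))"]
      by (simp add: T2_def op_scaleC_scaleC)
    moreover have "X = (1/2) *\<^sub>R (X + Y) + (1/2) *\<^sub>R (X - Y)" for X Y :: "'h \<Rightarrow>\<^sub>L 'h"
      by (simp add: scaleR_2[symmetric] flip: scaleR_right_distrib)
    ultimately show ?thesis
      by (simp only: T1_def)
  qed
  show ?thesis
  proof (intro bexI ballI)
    show "V + op_scaleC \<i> W \<in> center U"
      using V W by (intro center_add center_scaleC)
    fix x y assume "x \<in> U" "y \<in> U"
    then show "commutator (T x) y = (V + op_scaleC \<i> W) o\<^sub>L commutator x y"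
      using V W by (simp add: T_eq[of x] commutator.add_left commutator_op_scaleC_left bounded_op
          comp_simps op_scaleC_comp)
  qed
qed

corollary (in commuting_map) central_remainder:
  "\<exists>W\<in>center U. \<forall>x\<in>U. T x - (W o\<^sub>L x) \<in> center U"
proof -
  obtain W where W: "W \<in> center U" "\<forall>x\<in>U. \<forall>y\<in>U. commutator (T x) y = W o\<^sub>L commutator x y"
    using commutator_implementation by blast
  have "T x - (W o\<^sub>L x) \<in> center U" if "x \<in> U" for x
    using that W by (intro mem_centerI) (auto simp: center_in commutator.diff_left commutator_center_comp)
  with W show ?thesis by blast
qed

section \<open>Lie polynomials and central elements\<close>

context von_neumann
begin

lemma lie_poly_in: "(\<And>i. i \<in> {1..n} \<Longrightarrow> A i \<in> U) \<Longrightarrow> lie_poly n A \<in> U"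
  by (induction n A rule: lie_poly.induct) auto

lemma lie_poly_center_comp:
  assumes "z \<in> center U" "\<And>i. i \<in> {1..n} \<Longrightarrow> A i \<in> U"
  shows "z o\<^sub>L lie_poly n A = lie_poly n (A(1 := z o\<^sub>L A 1))"
  using assms
proof (induction n A rule: lie_poly.induct)
  case (3 n A)
  have "lie_poly (Suc n) A \<in> U"
    using "3.prems" by (intro lie_poly_in) auto
  then have "z o\<^sub>L lie_poly (Suc (Suc n)) A = commutator (z o\<^sub>L lie_poly (Suc n) A) (A (Suc (Suc n)))"
    using "3.prems" by (simp add: commutator_center_comp)
  also have "z o\<^sub>L lie_poly (Suc n) A = lie_poly (Suc n) (A(1 := z o\<^sub>L A 1))"
    using "3.prems" by (intro "3.IH") auto
  finally show ?case
    by (simp add: fun_upd_def)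
qed auto

text \<open>For \<open>n \<ge> 2\<close> every argument sits inside some commutator, where a central
  summand vanishes.\<close>

lemma lie_poly_add_center:
  assumes z: "z \<in> center U" and X: "X \<in> U" and A: "\<And>i. i \<in> {1..n} \<Longrightarrow> A i \<in> U"
    and "n \<ge> 2" and "i \<in> {1..n}"
  shows "lie_poly n (A(i := X + z)) = lie_poly n (A(i := X))"
  using \<open>n \<ge> 2\<close> A \<open>i \<in> {1..n}\<close>
proof (induction n rule: dec_induct)
  case base
  then consider "i = 1" | "i = 2" by fastforce
  then show ?case
  proof cases
    case 1
    then show ?thesis
      using base z X by (simp add: numeral_2_eq_2 commutator.add_left commutator_center)
  next
    case 2
    then show ?thesis
      using base z X by (simp add: numeral_2_eq_2 commutator.add_right commutator_center')
  qed
next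
  case (step n)
  then obtain m where m: "n = Suc m" by (metis Suc_le_D numeral_2_eq_2)
  show ?case
  proof (cases "i = Suc n")
    case True
    have "lie_poly n (A(i := Y)) = lie_poly n A" for Y
      using True by (intro lie_poly_cong) auto
    then have "lie_poly (Suc n) (A(i := Y)) = commutator (lie_poly n A) Y" for Y
      using True by (simp only: m lie_poly.simps(3) fun_upd_same)
    moreover have "lie_poly n A \<in> U"
      using step.prems by (intro lie_poly_in) auto
    ultimately show ?thesis
      using z by (simp only: commutator.add_right commutator_center') simp
  next
    case False
    then have "lie_poly n (A(i := X + z)) = lie_poly n (A(i := X))"
      using step.prems by (intro step.IH) auto
    then show ?thesis
      using False[symmetric] unfolding m lie_poly.simps(3) by (simp only: fun_upd_other) simp
  qed
qed

end

theorem corollary3p4: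
  fixes U :: "('h::complex_hilbert_space \<Rightarrow>\<^sub>L 'h) set"
    and L G :: "('h \<Rightarrow>\<^sub>L 'h) \<Rightarrow> ('h \<Rightarrow>\<^sub>L 'h)"
    and n :: nat
  assumes "n \<ge> 2"
    and "von_neumann_algebra U"
    and "generalized_lie_n_derivation n U L G"
  shows "\<exists>W \<in> center U. \<exists>chi. lie_n_derivation n U chi \<and> (\<forall>A\<in>U. G A = (W o\<^sub>L A) + chi A)"
proof -
  interpret von_neumann U
    by unfold_locales (rule assms(2))
  have L_in: "L A \<in> U" and G_in: "G A \<in> U"
    and L_scaleC: "L (op_scaleC c A) = op_scaleC c (L A)" and G_scaleC: "G (op_scaleC c A) = op_scaleC c (G A)"
    if "A \<in> U" for c A
    using assms(3) that
    unfolding generalized_lie_n_derivation_def lie_n_derivation_def linear_self_map_def by blast+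
  have L_add: "L (A + B) = L A + L B" and G_add: "G (A + B) = G A + G B" if "A \<in> U" "B \<in> U" for A B
    using assms(3) that
    unfolding generalized_lie_n_derivation_def lie_n_derivation_def linear_self_map_def by blast+
  have L_lie: "L (lie_poly n A) = (\<Sum>i\<in>{1..n}. lie_poly n (A(i := L (A i))))"
    and G_lie: "G (lie_poly n A) =
      lie_poly n (A(1 := G (A 1))) + (\<Sum>i\<in>{2..n}. lie_poly n (A(i := L (A i))))"
    if "\<forall>i\<in>{1..n}. A i \<in> U" for A
    using assms(3) that unfolding generalized_lie_n_derivation_def lie_n_derivation_def by blast+
  define T where "T A = G A - L A" for A
  \<comment> \<open>\<open>G\<close> and \<open>L\<close> have the same summands for
    \<open>i \<ge> 2\<close>, so only the first argument survives in the difference.\<close>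
  have T_lie: "T (lie_poly n A) = lie_poly n (A(1 := T (A 1)))" if "\<forall>i\<in>{1..n}. A i \<in> U" for A
  proof -
    have "{1..n} = insert 1 {2..n}"
      using assms(1) by auto
    then show ?thesis
      by (simp add: T_def L_lie[OF that] G_lie[OF that] lie_poly_first_diff[unfolded One_nat_def])
  qed
  have T_in: "T A \<in> U" if "A \<in> U" for A
    using that by (simp add: T_def L_in G_in)
  have T_add: "T (A + B) = T A + T B" if "A \<in> U" "B \<in> U" for A B
    using that by (simp add: T_def L_add G_add)
  have T_scaleR: "T (r *\<^sub>R A) = r *\<^sub>R T A" if "A \<in> U" for r A
    using L_scaleC[OF that, of "complex_of_real r"] G_scaleC[OF that, of "complex_of_real r"]
    by (simp add: T_def op_scaleC_of_real scaleR_diff_right)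
  interpret commuting_map U T
  proof (unfold_locales)
    fix A B assume "A \<in> U" "B \<in> U"
    then show "commutator (T A) B = commutator A (T B)"
    proof (intro commuting_if_commuting_mod_center[of T A B] T_in T_add)
      fix A B assume "A \<in> U" "B \<in> U"
      show "commutator (T A) B - commutator A (T B) \<in> center U"
      proof (rule commuting_mod_center_of_lie_n_centralizer[OF assms(1) T_in])
        show "T (- A) = - T A" if "A \<in> U" for A
          using T_scaleR[OF that, of "- 1"] by simp
      qed (use T_lie \<open>A \<in> U\<close> \<open>B \<in> U\<close> in auto)
    qed
  qed (use T_in T_add T_scaleR in auto)
  obtain W where W: "W \<in> center U" and remainder: "\<And>A. A \<in> U \<Longrightarrow> T A - (W o\<^sub>L A) \<in> center U"
    using central_remainder by blast
  have WU: "W \<in> U" using W by (rule center_in)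
  define chi where "chi A = G A - (W o\<^sub>L A)" for A
  \<comment> \<open>\<open>chi\<close> is \<open>L\<close> plus a central valued map that vanishes
    on all values of \<open>lie_poly n\<close>. The addition changes neither side of the identity
    for \<open>L\<close>, so \<open>chi\<close> inherits it.\<close>
  have chi_eq: "chi A = L A + (T A - (W o\<^sub>L A))" for A
    by (simp add: chi_def T_def)
  have "chi (lie_poly n A) = (\<Sum>i\<in>{1..n}. lie_poly n (A(i := chi (A i))))"
    if A: "\<forall>i\<in>{1..n}. A i \<in> U" for A
  proof -
    have A1: "A 1 \<in> U" using A assms(1) by auto
    \<comment> \<open>The summand \<open>0\<close> presents the first argument as a central shift of
      zero, the shape that \<open>lie_poly_add_center\<close> expects.\<close>
    have "T (lie_poly n A) - (W o\<^sub>L lie_poly n A) = lie_poly n (A(1 := 0 + (T (A 1) - (W o\<^sub>L A 1))))"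
      using A lie_poly_center_comp[OF W, of n A] by (simp add: T_lie lie_poly_first_diff[unfolded One_nat_def])
    also have "\<dots> = lie_poly n (A(1 := 0))"
      using A A1 assms(1) by (intro lie_poly_add_center remainder) auto
    also have "\<dots> = 0"
      by (rule lie_poly_first_zero)
    finally have "chi (lie_poly n A) = L (lie_poly n A)"
      by (simp add: chi_eq)
    also have "\<dots> = (\<Sum>i\<in>{1..n}. lie_poly n (A(i := L (A i))))"
      by (rule L_lie[OF A])
    also have "\<dots> = (\<Sum>i\<in>{1..n}. lie_poly n (A(i := chi (A i))))"
      unfolding chi_eq using A assms(1)
      by (intro sum.cong refl lie_poly_add_center[symmetric] remainder L_in) auto
    finally show ?thesis .
  qed
  moreover have "linear_self_map U chi"
    unfolding linear_self_map_def chi_def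
    by (simp add: G_in G_add G_scaleC WU bounded_op comp_simps comp_op_scaleC op_scaleC_diff_right)
  ultimately have "lie_n_derivation n U chi"
    unfolding lie_n_derivation_def by blast
  moreover have "\<forall>A\<in>U. G A = (W o\<^sub>L A) + chi A"
    by (simp add: chi_def)
  ultimately show ?thesis
    using W by blast
qed

end
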